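(* Let $\mathcal{S}$ be a stable semigroup with finitely many $\mathscr{J}$-classes and let $\mathcal{G}$ be the direct product of all maximal subgroups of $\mathcal{S}$. Then there exists a polynomial reduction from the problem $\textsc{Check-Id}(\mathcal{G})$ to the problem $\textsc{Check-Id}(\mathcal{S})$.
   Context: **Identities.** A semigroup word is a nonempty finite sequence of letters. An identity is a pair $(w,w')$ of semigroup words, written $w\bumpeq w'$; $\mathrm{alph}(w)$ denotes the set of letters occurring in $w$. A semigroup $\mathcal{S}$ satisfies $w\bumpeq w'$ (the identity holds in $\mathcal{S}$) if $\varphi(w)=\varphi(w')$ for every substitution $\varphi\colon \mathrm{alph}(ww')\to\mathcal{S}$, where $\varphi(w)$ is the element of $\mathcal{S}$ obtained by replacing each letter $x$ of $w$ by $\varphi(x)$ and computing the product in $\mathcal{S}$. **Problem.** For a fixed semigroup $\mathcal{S}$, $\textsc{Check-Id}(\mathcal{S})$ is the decision problem whose instance is an identity $w\bumpeq w'$ (the size of the instance is measured by the length of $ww'$), and whose answer is YES if $\mathcal{S}$ satisfies $w\bumpeq w'$ and NO otherwise. **Polynomial reduction.** A polynomial reduction from $\textsc{Check-Id}(\mathcal{G})$ to $\textsc{Check-Id}(\mathcal{S})$ means: given an arbitrary identity $u\bumpeq v$, one can construct (in polynomial time) an identity $U\bumpeq V$ such that (Size) the lengths of $U$ and $V$ are bounded by the values of a fixed polynomial in the lengths of $u$ and $v$; and (Equi) $U\bumpeq V$ holds in $\mathcal{S}$ if and only if $u\bumpeq v$ holds in $\mathcal{G}$. **Semigroup notions.**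 $\mathcal{S}^1$ is $\mathcal{S}$ if $\mathcal{S}$ is a monoid, and otherwise $\mathcal{S}$ with an identity element adjoined. Write $a\le_{\mathscr{L}}b$ if $a\in\mathcal{S}^1b$, $a\le_{\mathscr{R}}b$ if $a\in b\mathcal{S}^1$, and $a\le_{\mathscr{J}}b$ if $a\in\mathcal{S}^1b\mathcal{S}^1$; $\mathscr{L},\mathscr{R},\mathscr{J}$ are the equivalence relations associated with these preorders. The semigroup $\mathcal{S}$ is stable if for all $a,b\in\mathcal{S}$: $a\,\mathscr{J}\,ab$ implies $a\,\mathscr{R}\,ab$, and $a\,\mathscr{J}\,ba$ implies $a\,\mathscr{L}\,ba$. A maximal subgroup of $\mathcal{S}$ is a subsemigroup that is a group and is maximal with respect to inclusion among such subsemigroups (equivalently, an $\mathscr{H}$-class containing an idempotent, where $\mathscr{H}=\mathscr{L}\cap\mathscr{R}$). *)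

theory Defs
  imports "HOL-Algebra.Product_Groups" "HOL-Computational_Algebra.Polynomial"
begin

section \<open>Identities\<close>

type_synonym letter = nat

type_synonym identity = "letter list \<times> letter list"

definition identities :: "identity set" where
  "identities = {(w, w'). w \<noteq> [] \<and> w' \<noteq> []}"

text \<open>The value of a nonempty word; the value of the empty word is unspecified.\<close>

fun word_value :: "('a \<Rightarrow> 'a \<Rightarrow> 'a) \<Rightarrow> (letter \<Rightarrow> 'a) \<Rightarrow> letter list \<Rightarrow> 'a" where
  "word_value f \<phi> [x] = \<phi> x"
| "word_value f \<phi> (x # y # w) = f (\<phi> x) (word_value f \<phi> (y # w))"

definition satisfies :: "'a set \<Rightarrow> ('a \<Rightarrow> 'a \<Rightarrow> 'a) \<Rightarrow> identity \<Rightarrow> bool" where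
  "satisfies S f = (\<lambda>(w, w').
     \<forall>\<phi> \<in> set (w @ w') \<rightarrow> S. word_value f \<phi> w = word_value f \<phi> w')"

text \<open>
  A decision problem about identities is given by its set of YES-instances, a subset of
  \<^const>\<open>identities\<close>.
\<close>

definition check_id :: "'a set \<Rightarrow> ('a \<Rightarrow> 'a \<Rightarrow> 'a) \<Rightarrow> identity set" where
  "check_id S f = {i \<in> identities. satisfies S f i}"


section \<open>Green's relations, stability, maximal subgroups\<close>

text \<open>
  In this section the semigroup is a whole type \<^typ>\<open>'a\<close> with multiplication \<open>f\<close>.
  The sets \<open>S\<^sup>1 b\<close> and \<open>b S\<^sup>1\<close> are computed without constructing \<open>S\<^sup>1\<close>:
  whether or not \<open>S\<close> already has an identity, \<open>S\<^sup>1 b = {b} \<union> S b\<close>, and dually.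
\<close>

definition S1_left :: "('a \<Rightarrow> 'a \<Rightarrow> 'a) \<Rightarrow> 'a \<Rightarrow> 'a set" where
  "S1_left f b = insert b {f s b | s. True}"

definition S1_right :: "('a \<Rightarrow> 'a \<Rightarrow> 'a) \<Rightarrow> 'a \<Rightarrow> 'a set" where
  "S1_right f b = insert b {f b s | s. True}"

definition le_L :: "('a \<Rightarrow> 'a \<Rightarrow> 'a) \<Rightarrow> 'a \<Rightarrow> 'a \<Rightarrow> bool" where
  "le_L f a b \<longleftrightarrow> a \<in> S1_left f b"

definition le_R :: "('a \<Rightarrow> 'a \<Rightarrow> 'a) \<Rightarrow> 'a \<Rightarrow> 'a \<Rightarrow> bool" where
  "le_R f a b \<longleftrightarrow> a \<in> S1_right f b"

definition le_J :: "('a \<Rightarrow> 'a \<Rightarrow> 'a) \<Rightarrow> 'a \<Rightarrow> 'a \<Rightarrow> bool" where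
  "le_J f a b \<longleftrightarrow> a \<in> (\<Union>c \<in> S1_right f b. S1_left f c)"

definition green_L :: "('a \<Rightarrow> 'a \<Rightarrow> 'a) \<Rightarrow> ('a \<times> 'a) set" where
  "green_L f = {(a, b). le_L f a b \<and> le_L f b a}"

definition green_R :: "('a \<Rightarrow> 'a \<Rightarrow> 'a) \<Rightarrow> ('a \<times> 'a) set" where
  "green_R f = {(a, b). le_R f a b \<and> le_R f b a}"

definition green_J :: "('a \<Rightarrow> 'a \<Rightarrow> 'a) \<Rightarrow> ('a \<times> 'a) set" where
  "green_J f = {(a, b). le_J f a b \<and> le_J f b a}"

definition stable_semigroup :: "('a \<Rightarrow> 'a \<Rightarrow> 'a) \<Rightarrow> bool" where
  "stable_semigroup f \<longleftrightarrow> (\<forall>a b.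
     ((a, f a b) \<in> green_J f \<longrightarrow> (a, f a b) \<in> green_R f) \<and>
     ((a, f b a) \<in> green_J f \<longrightarrow> (a, f b a) \<in> green_L f))"

text \<open>
  The group laws of HOL-Algebra include closure of the carrier, so this says that \<open>H\<close> is a
  subsemigroup which is a group. Its identity \<open>e\<close> is just some idempotent of the semigroup.
\<close>

definition is_subgroup :: "('a \<Rightarrow> 'a \<Rightarrow> 'a) \<Rightarrow> 'a set \<Rightarrow> bool" where
  "is_subgroup f H \<longleftrightarrow> (\<exists>e. group \<lparr>carrier = H, monoid.mult = f, one = e\<rparr>)"

definition subgroup_of :: "('a \<Rightarrow> 'a \<Rightarrow> 'a) \<Rightarrow> 'a set \<Rightarrow> 'a monoid" where
  "subgroup_of f H =
     \<lparr>carrier = H, monoid.mult = f,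
      one = (THE e. group \<lparr>carrier = H, monoid.mult = f, one = e\<rparr>)\<rparr>"

definition maximal_subgroups :: "('a \<Rightarrow> 'a \<Rightarrow> 'a) \<Rightarrow> 'a set set" where
  "maximal_subgroups f =
     {H. is_subgroup f H \<and> (\<forall>K. is_subgroup f K \<longrightarrow> H \<subseteq> K \<longrightarrow> K = H)}"

definition maximal_subgroups_product :: "('a \<Rightarrow> 'a \<Rightarrow> 'a) \<Rightarrow> ('a set \<Rightarrow> 'a) monoid" where
  "maximal_subgroups_product f = product_group (maximal_subgroups f) (subgroup_of f)"


section \<open>Polynomial time\<close>

text \<open>
  The model of computation is the random access machine of Cook and Reckhow (1973): registers
  \<open>X\<^sub>0, X\<^sub>1, \<dots>\<close> holding numbers, a read-only input sequence and a write-only output sequence,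
  the usual instructions (constants, addition, subtraction, indirect loads and stores, input,
  output), and unit cost per instruction. Control flow is by structured programs instead of
  jumps. Subtraction is truncated. There is no multiplication, so register contents
  have at most linearly more bits after \<open>t\<close> steps, and polynomial time is the usual
  (Turing machine) notion.

  A letter occupies one cell of the input, so that the size of an instance is its number of
  letter occurrences.
\<close>

datatype instr =
    Const nat nat        \<comment> \<open>\<open>X\<^sub>i := c\<close>\<close>
  | Add nat nat nat      \<comment> \<open>\<open>X\<^sub>i := X\<^sub>j + X\<^sub>k\<close>\<close>
  | Sub nat nat nat      \<comment> \<open>\<open>X\<^sub>i := X\<^sub>j - X\<^sub>k\<close>\<close>
  | Load nat nat         \<comment> \<open>\<open>X\<^sub>i := X\<^bsub>X\<^sub>j\<^esub>\<close>\<close>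
  | Store nat nat        \<comment> \<open>\<open>X\<^bsub>X\<^sub>i\<^esub> := X\<^sub>j\<close>\<close>
  | Read nat             \<comment> \<open>consume the next input number into \<open>X\<^sub>i\<close>; \<open>0\<close> if there is none\<close>
  | Print nat            \<comment> \<open>append \<open>X\<^sub>i\<close> to the output\<close>

datatype prog =
    Instr instr
  | Seq prog prog
  | If nat prog prog     \<comment> \<open>first branch if \<open>X\<^sub>i > 0\<close>\<close>
  | While nat prog       \<comment> \<open>while \<open>X\<^sub>i > 0\<close>\<close>

text \<open>Register contents, remaining input, output so far.\<close>

type_synonym state = "(nat \<Rightarrow> nat) \<times> nat list \<times> nat list"

fun step :: "instr \<Rightarrow> state \<Rightarrow> state" where
  "step (Const i c) (X, inp, out) = (X(i := c), inp, out)"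
| "step (Add i j k) (X, inp, out) = (X(i := X j + X k), inp, out)"
| "step (Sub i j k) (X, inp, out) = (X(i := X j - X k), inp, out)"
| "step (Load i j) (X, inp, out) = (X(i := X (X j)), inp, out)"
| "step (Store i j) (X, inp, out) = (X(X i := X j), inp, out)"
| "step (Read i) (X, inp, out) =
     (case inp of [] \<Rightarrow> (X(i := 0), [], out) | a # inp' \<Rightarrow> (X(i := a), inp', out))"
| "step (Print i) (X, inp, out) = (X, inp, out @ [X i])"

text \<open>\<open>exec p s t s'\<close>: started in \<open>s\<close>, program \<open>p\<close> halts in \<open>s'\<close> after exactly \<open>t\<close> steps.\<close>

inductive exec :: "prog \<Rightarrow> state \<Rightarrow> nat \<Rightarrow> state \<Rightarrow> bool" where
  exec_Instr: "exec (Instr c) s 1 (step c s)"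
| exec_Seq: "\<lbrakk>exec p s t1 s1; exec q s1 t2 s2\<rbrakk> \<Longrightarrow> exec (Seq p q) s (t1 + t2) s2"
| exec_IfTrue: "\<lbrakk>fst s i > 0; exec p s t s'\<rbrakk> \<Longrightarrow> exec (If i p q) s (t + 1) s'"
| exec_IfFalse: "\<lbrakk>fst s i = 0; exec q s t s'\<rbrakk> \<Longrightarrow> exec (If i p q) s (t + 1) s'"
| exec_WhileFalse: "fst s i = 0 \<Longrightarrow> exec (While i p) s 1 s"
| exec_WhileTrue: "\<lbrakk>fst s i > 0; exec p s t1 s1; exec (While i p) s1 t2 s2\<rbrakk>
    \<Longrightarrow> exec (While i p) s (t1 + t2 + 1) s2"

lemma exec_deterministic:
  "exec p s t s1 \<Longrightarrow> exec p s t' s2 \<Longrightarrow> t' = t \<and> s2 = s1"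
proof (induction arbitrary: t' s2 rule: exec.induct)
  case (exec_Instr c s)
  then show ?case by cases simp
next
  case seq: (exec_Seq p s t1 s1 q t2 s2)
  from seq.prems show ?case
  proof cases
    case (exec_Seq t1' s1' t2')
    then show ?thesis using seq.IH by metis
  qed
next
  case ift: (exec_IfTrue s i p t s' q)
  from ift.prems show ?case
  proof cases
    case (exec_IfTrue t'')
    then show ?thesis using ift.IH by blast
  next
    case (exec_IfFalse t'')
    then show ?thesis using ift.hyps(1) by simp
  qed
next
  case iff: (exec_IfFalse s i q t s' p)
  from iff.prems show ?case
  proof cases
    case (exec_IfTrue t'')
    then show ?thesis using iff.hyps(1) by simp
  next
    case (exec_IfFalse t'')
    then show ?thesis using iff.IH by blast
  qed
next
  case whf: (exec_WhileFalse s i p)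
  from whf.prems show ?case by cases (simp_all add: whf.hyps)
next
  case while: (exec_WhileTrue s i p t1 s1 t2 s2)
  from while.prems show ?case
  proof cases
    case exec_WhileFalse
    then show ?thesis using while.hyps(1) by simp
  next
    case (exec_WhileTrue t1' s1' t2')
    then show ?thesis using while.IH by metis
  qed
qed

text \<open>The letter \<open>x\<close> is written as \<open>x + 1\<close>; each word is terminated by \<open>0\<close>.\<close>

definition encode :: "identity \<Rightarrow> nat list" where
  "encode = (\<lambda>(w, w'). map Suc w @ [0] @ map Suc w' @ [0])"

definition polytime_computable :: "(identity \<Rightarrow> identity) \<Rightarrow> bool" where
  "polytime_computable F \<longleftrightarrow> (\<exists>(p :: prog) (T :: nat poly). \<forall>(u, v) \<in> identities.
     \<exists>t X inp. exec p (\<lambda>_. 0, encode (u, v), []) t (X, inp, encode (F (u, v))) \<and>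
       t \<le> poly T (length (u @ v)))"

text \<open>
  Polynomials in two variables are polynomials in the second one whose coefficients are
  polynomials in the first one.
\<close>

definition poly2 :: "nat poly poly \<Rightarrow> nat \<Rightarrow> nat \<Rightarrow> nat" where
  "poly2 P m n = poly (poly P [:n:]) m"

definition polynomial_reduction ::
    "(identity \<Rightarrow> identity) \<Rightarrow> identity set \<Rightarrow> identity set \<Rightarrow> bool" where
  "polynomial_reduction F A B \<longleftrightarrow>
     F \<in> identities \<rightarrow> identities \<and>
     polytime_computable F \<and>
     (\<exists>P. \<forall>(u, v) \<in> identities. case F (u, v) of (U, V) \<Rightarrow>
        length U \<le> poly2 P (length u) (length v) \<and>
        length V \<le> poly2 P (length u) (length v)) \<and>
     (\<forall>i \<in> identities. F i \<in> B \<longleftrightarrow> i \<in> A)"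

end

theory Submission
  imports Defs
begin

text \<open>
  Let \<open>u \<bumpeq> v\<close> be an identity, and let \<open>y\<close> be a letter that does not occur in it. Consider the
  substitution \<open>\<tau>\<close> that sends every letter \<open>x\<close> of \<open>uv\<close> to \<open>y x y\<close>, and \<open>y\<close> to
  \<open>y \<cdot> (y x\<^sub>1 y) \<cdots> (y x\<^sub>n y)\<close>, where \<open>x\<^sub>1 \<dots> x\<^sub>n = uv\<close>. With \<open>k\<close> the number of
  \<open>\<J>\<close>-classes of the semigroup, the reduction maps \<open>u \<bumpeq> v\<close> to
  \<open>\<tau>\<^sup>k(u) \<bumpeq> \<tau>\<^sup>k(v)\<close>. Two properties of \<open>\<tau>\<close> make this work.

  \<^item> It extends to an automorphism of the free group on \<open>y\<close> and the letters of \<open>uv\<close>. Hence in a group every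
    assignment \<open>\<chi>\<close> of values to letters arises as \<open>\<psi> \<circ> \<tau>\<^sup>k\<close> for some assignment \<open>\<psi>\<close>, and
    so \<open>\<tau>\<^sup>k(u) \<bumpeq> \<tau>\<^sup>k(v)\<close> implies \<open>u \<bumpeq> v\<close> in every subgroup of the semigroup
    (\<open>iterated_advance_in_group_surjective\<close>).

  \<^item> For every assignment \<open>\<phi>\<close> in the semigroup, the values \<open>\<phi>(\<tau>\<^sup>k(x))\<close> of the letters \<open>x\<close> of \<open>uv\<close>
    lie in one common maximal subgroup, so that an identity of that subgroup holds for them
    (\<open>iterated_advance_in_maximal_subgroup\<close>). Indeed \<open>\<tau>\<^sup>j\<^sup>+\<^sup>1(y)\<close> starts with \<open>\<tau>\<^sup>j(y)\<close>, so the values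
    \<open>a\<^sub>j = \<phi>(\<tau>\<^sup>j(y))\<close> descend in the \<open>\<J>\<close>-order, and \<open>a\<^sub>j \<J> a\<^sub>j\<^sub>+\<^sub>1\<close> for
    some \<open>j < k\<close>. The products \<open>a\<^sub>j a\<^sub>j\<close> and \<open>a\<^sub>j \<phi>(\<tau>\<^sup>j(x)) a\<^sub>j\<close> are factors of
    \<open>a\<^sub>j\<^sub>+\<^sub>1\<close>, hence \<open>\<J>\<close>-equivalent to \<open>a\<^sub>j\<close>. By stability, the former puts
    \<open>a\<^sub>j\<close> into a maximal subgroup, and the latter then puts all \<open>\<phi>(\<tau>\<^sup>j\<^sup>+\<^sup>1(x))\<close> into the same
    subgroup. Further applications of \<open>\<tau>\<close> only multiply elements of this subgroup.

  Since \<open>k\<close> depends only on the semigroup, the words \<open>\<tau>\<^sup>k(x)\<close> have polynomial length, and a program with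
  loops nested to a fixed depth prints the image of the identity. The length bound is a consequence of the
  time bound, as a machine prints at most one number per step.
\<close>

section \<open>Values of words\<close>

lemma word_value_Cons: "w \<noteq> [] \<Longrightarrow> word_value f \<phi> (x # w) = f (\<phi> x) (word_value f \<phi> w)"
  by (cases w) auto

lemma word_value_cong:
  "w \<noteq> [] \<Longrightarrow> (\<And>x. x \<in> set w \<Longrightarrow> \<phi> x = \<psi> x) \<Longrightarrow> word_value f \<phi> w = word_value f \<psi> w"
  by (induction w rule: list_nonempty_induct) (auto simp: word_value_Cons)

lemma word_value_closed:
  assumes "w \<noteq> []" "\<And>x. x \<in> set w \<Longrightarrow> \<phi> x \<in> H" "\<And>a b. a \<in> H \<Longrightarrow> b \<in> H \<Longrightarrow> f a b \<in> H"
  shows "word_value f \<phi> w \<in> H"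
  using assms(1,2) by (induction w rule: list_nonempty_induct) (auto simp: word_value_Cons assms(3))

lemma (in semigroup) word_value_append:
  "v \<noteq> [] \<Longrightarrow> w \<noteq> [] \<Longrightarrow> word_value f \<phi> (v @ w) = word_value f \<phi> v \<^bold>* word_value f \<phi> w"
  by (induction v rule: list_nonempty_induct) (auto simp: word_value_Cons assoc)

lemma (in semigroup) word_value_concat:
  assumes "w \<noteq> []" "\<And>x. s x \<noteq> []"
  shows "word_value f \<phi> (concat (map s w)) = word_value f (\<lambda>x. word_value f \<phi> (s x)) w"
  using assms(1)
proof (induction w rule: list_nonempty_induct)
  case (cons x xs)
  moreover have "concat (map s xs) \<noteq> []" using cons.hyps assms(2) by (cases xs) auto
  ultimately show ?case using assms(2) by (simp add: word_value_append word_value_Cons)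
qed simp

section \<open>The substitution\<close>

text \<open>
  One application of the substitution \<open>\<tau>\<close>, with the letter \<open>0\<close> as the new letter \<open>y\<close>. The product in
  the image of \<open>0\<close> runs over the occurrences of letters in \<open>w\<close> instead of the distinct letters, so
  that a machine can print it in one pass over its input.
\<close>

definition mix :: "letter list \<Rightarrow> letter \<Rightarrow> letter list" where
  "mix w x = (if x = 0 then 0 # concat (map (\<lambda>z. [0, z, 0]) w) else [0, x, 0])"

primrec iterated_mix :: "letter list \<Rightarrow> nat \<Rightarrow> letter \<Rightarrow> letter list" where
  "iterated_mix w 0 x = [x]"
| "iterated_mix w (Suc j) x = concat (map (iterated_mix w j) (mix w x))"

text \<open>
  Substituting in words and then evaluating amounts to changing the assignment and then evaluating. This is
  the assignment after one application of the substitution \<^term>\<open>mix w\<close>.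
\<close>

definition advance :: "('a \<Rightarrow> 'a \<Rightarrow> 'a) \<Rightarrow> letter list \<Rightarrow> (letter \<Rightarrow> 'a) \<Rightarrow> letter \<Rightarrow> 'a" where
  "advance f w \<psi> x = word_value f \<psi> (mix w x)"

lemma mix_nonempty [simp]: "mix w x \<noteq> []"
  by (simp add: mix_def)

lemma iterated_mix_nonempty [simp]: "iterated_mix w j x \<noteq> []"
proof (induction j arbitrary: x)
  case (Suc j)
  have "mix w x \<noteq> []" by simp
  then show ?case using Suc.IH by (cases "mix w x") simp_all
qed simp

lemma iterated_mix_nonzero:
  "x \<noteq> 0 \<Longrightarrow>
    iterated_mix w (Suc j) x = iterated_mix w j 0 @ iterated_mix w j x @ iterated_mix w j 0"
  by (simp add: mix_def)

lemma iterated_mix_zero: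
  "iterated_mix w (Suc j) 0 = iterated_mix w j 0 @
    concat (map (\<lambda>z. iterated_mix w j 0 @ iterated_mix w j z @ iterated_mix w j 0) w)"
proof -
  have "concat (map s (concat (map (\<lambda>z. [0, z, 0]) v))) = concat (map (\<lambda>z. s 0 @ s z @ s 0) v)"
    for s :: "letter \<Rightarrow> letter list" and v
    by (induction v) simp_all
  then show ?thesis by (simp add: mix_def)
qed

lemma (in semigroup) word_value_iterated_mix:
  "word_value f \<phi> (iterated_mix w j x) = (advance f w ^^ j) \<phi> x"
proof (induction j arbitrary: x)
  case (Suc j)
  then show ?case
    by (simp add: word_value_concat advance_def)
qed simp

lemma (in semigroup) word_value_concat_iterated_mix:
  "v \<noteq> [] \<Longrightarrow>
    word_value f \<phi> (concat (map (iterated_mix w j) v)) = word_value f ((advance f w ^^ j) \<phi>) v"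
  by (simp add: word_value_concat word_value_iterated_mix)

lemma (in semigroup) advance_nonzero: "x \<noteq> 0 \<Longrightarrow> advance f w \<psi> x = \<psi> 0 \<^bold>* \<psi> x \<^bold>* \<psi> 0"
  by (simp add: advance_def mix_def assoc)

text \<open>
  The value of the letter \<open>0\<close> is multiplied on the right by the \<^emph>\<open>new\<close> values of the letters of \<open>w\<close>.
  This makes the values descend in the \<open>\<J>\<close>-order, and in a group it allows recovering the old value of
  \<open>0\<close> from the new assignment.
\<close>

lemma (in semigroup) advance_zero:
  assumes "w \<noteq> []" "0 \<notin> set w"
  shows "advance f w \<psi> 0 = \<psi> 0 \<^bold>* word_value f (advance f w \<psi>) w"
proof -
  have "concat (map (\<lambda>z. [0, z, 0]) w) \<noteq> []" using assms(1) by (cases w) auto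
  then have "advance f w \<psi> 0 = \<psi> 0 \<^bold>* word_value f (\<lambda>z. word_value f \<psi> [0, z, 0]) w"
    using assms(1) by (simp add: advance_def mix_def word_value_Cons word_value_concat)
  moreover have "word_value f (\<lambda>z. word_value f \<psi> [0, z, 0]) w = word_value f (advance f w \<psi>) w"
  proof (rule word_value_cong[OF assms(1)])
    fix z assume "z \<in> set w"
    then have "z \<noteq> 0" using assms(2) by metis
    then show "word_value f \<psi> [0, z, 0] = advance f w \<psi> z" by (simp add: advance_nonzero assoc)
  qed
  ultimately show ?thesis by simp
qed

text \<open>
  The system \<open>y p = \<chi>(0)\<close>, \<open>y \<psi>(x) y = \<chi>(x)\<close>, in which \<open>p\<close> is the product of the given values
  \<open>\<chi>(x)\<close> along \<open>w\<close>, is solved by \<open>y = \<chi>(0) p\<^sup>-\<^sup>1\<close> and \<open>\<psi>(x) = y\<^sup>-\<^sup>1 \<chi>(x) y\<^sup>-\<^sup>1\<close>.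
\<close>

lemma (in semigroup) advance_in_group_surjective:
  assumes "group \<lparr>carrier = H, monoid.mult = f, one = e\<rparr>"
    and "w \<noteq> []" "0 \<notin> set w" and "\<forall>x. \<chi> x \<in> H"
  shows "\<exists>\<psi>. (\<forall>x. \<psi> x \<in> H) \<and> advance f w \<psi> = \<chi>"
proof -
  let ?G = "\<lparr>carrier = H, monoid.mult = f, one = e\<rparr>"
  interpret G: group ?G by fact
  have closed: "a \<^bold>* b \<in> H" if "a \<in> H" "b \<in> H" for a b using G.m_closed that by simp
  have inv: "inv\<^bsub>?G\<^esub> a \<in> H" "inv\<^bsub>?G\<^esub> a \<^bold>* a = e" "a \<^bold>* inv\<^bsub>?G\<^esub> a = e"
    "e \<^bold>* a = a" "a \<^bold>* e = a" if "a \<in> H" for a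
    using that G.inv_closed G.l_inv G.r_inv G.l_one G.r_one by simp_all
  define p where "p = word_value f \<chi> w"
  have p: "p \<in> H" unfolding p_def by (rule word_value_closed) (use assms closed in auto)
  define y where "y = \<chi> 0 \<^bold>* inv\<^bsub>?G\<^esub> p"
  define \<psi> where "\<psi> x = (if x = 0 then y else inv\<^bsub>?G\<^esub> y \<^bold>* (\<chi> x \<^bold>* inv\<^bsub>?G\<^esub> y))" for x
  have y: "y \<in> H" unfolding y_def by (intro closed inv(1) assms(4)[rule_format] p)
  have 1: "\<forall>x. \<psi> x \<in> H" unfolding \<psi>_def using assms(4) y inv(1) closed by simp
  have nonzero: "advance f w \<psi> x = \<chi> x" if "x \<noteq> 0" for x
  proof -
    have "advance f w \<psi> x = (y \<^bold>* inv\<^bsub>?G\<^esub> y) \<^bold>* (\<chi> x \<^bold>* (inv\<^bsub>?G\<^esub> y \<^bold>* y))"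
      using that by (simp add: advance_nonzero \<psi>_def assoc)
    also have "\<dots> = \<chi> x" using inv y assms(4) by simp
    finally show ?thesis .
  qed
  have "word_value f (advance f w \<psi>) w = p"
    unfolding p_def by (rule word_value_cong[OF assms(2)]) (metis nonzero assms(3))
  then have "advance f w \<psi> 0 = \<chi> 0 \<^bold>* (inv\<^bsub>?G\<^esub> p \<^bold>* p)"
    by (simp add: advance_zero[OF assms(2,3)] \<psi>_def y_def assoc)
  then have "advance f w \<psi> 0 = \<chi> 0" using inv p assms(4) by simp
  then have "advance f w \<psi> = \<chi>" using nonzero by (metis ext)
  then show ?thesis using 1 by blast
qed

lemma (in semigroup) iterated_advance_in_group_surjective:
  assumes "group \<lparr>carrier = H, monoid.mult = f, one = e\<rparr>"
    and "w \<noteq> []" "0 \<notin> set w" and "\<forall>x. \<chi> x \<in> H"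
  shows "\<exists>\<psi>. (\<forall>x. \<psi> x \<in> H) \<and> (advance f w ^^ j) \<psi> = \<chi>"
  using assms(4)
proof (induction j arbitrary: \<chi>)
  case 0
  then show ?case by (intro exI[of _ \<chi>]) simp
next
  case (Suc j)
  obtain \<xi> where \<xi>: "\<forall>x. \<xi> x \<in> H" "advance f w \<xi> = \<chi>"
    using advance_in_group_surjective[OF assms(1-3) Suc.prems] by (elim exE conjE)
  have "\<exists>\<psi>. (\<forall>x. \<psi> x \<in> H) \<and> (advance f w ^^ j) \<psi> = \<xi>"
    by (rule Suc.IH[OF \<xi>(1)])
  then obtain \<psi> where "\<forall>x. \<psi> x \<in> H" "(advance f w ^^ j) \<psi> = \<xi>"
    by (elim exE conjE)
  with \<xi>(2) show ?case by (intro exI[of _ \<psi>]) simp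
qed

lemma (in semigroup) advance_closed:
  assumes "\<And>a b. a \<in> H \<Longrightarrow> b \<in> H \<Longrightarrow> a \<^bold>* b \<in> H"
    and "w \<noteq> []" "0 \<notin> set w" and "x \<in> insert 0 (set w)"
    and "\<And>z. z \<in> insert 0 (set w) \<Longrightarrow> \<psi> z \<in> H"
  shows "advance f w \<psi> x \<in> H"
  unfolding advance_def
  by (rule word_value_closed) (use assms in \<open>auto simp: mix_def split: if_splits\<close>)

section \<open>Maximal subgroups\<close>

text \<open>
  The group of units of the monoid \<open>e S e\<close>, for an idempotent \<open>e\<close>. Equivalently, the
  \<open>\<H>\<close>-class of \<open>e\<close>; the description by units avoids Green's lemma.
\<close>

definition units_at :: "('a \<Rightarrow> 'a \<Rightarrow> 'a) \<Rightarrow> 'a \<Rightarrow> 'a set" where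
  "units_at f e = {b. f e b = b \<and> f b e = b \<and>
     (\<exists>c. f e c = c \<and> f c e = c \<and> f b c = e \<and> f c b = e)}"

lemma (in semigroup) group_units_at:
  assumes "e \<^bold>* e = e"
  shows "group \<lparr>carrier = units_at f e, monoid.mult = f, one = e\<rparr>"
proof (rule groupI, simp_all)
  show "e \<in> units_at f e" using assms by (auto simp: units_at_def)
next
  fix a b assume a: "a \<in> units_at f e" and b: "b \<in> units_at f e"
  then obtain a' b' where inv: "e \<^bold>* a' = a'" "a' \<^bold>* e = a'" "a \<^bold>* a' = e" "a' \<^bold>* a = e"
    "e \<^bold>* b' = b'" "b' \<^bold>* e = b'" "b \<^bold>* b' = e" "b' \<^bold>* b = e"
    by (auto simp: units_at_def)
  have ab: "e \<^bold>* a = a" "a \<^bold>* e = a" "e \<^bold>* b = b" "b \<^bold>* e = b"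
    using a b by (auto simp: units_at_def)
  have "e \<^bold>* (a \<^bold>* b) = a \<^bold>* b" "(a \<^bold>* b) \<^bold>* e = a \<^bold>* b"
    "e \<^bold>* (b' \<^bold>* a') = b' \<^bold>* a'" "(b' \<^bold>* a') \<^bold>* e = b' \<^bold>* a'"
    "(a \<^bold>* b) \<^bold>* (b' \<^bold>* a') = e" "(b' \<^bold>* a') \<^bold>* (a \<^bold>* b) = e"
    using inv ab by (metis assoc)+
  then show "a \<^bold>* b \<in> units_at f e" unfolding units_at_def by blast
next
  fix a assume "a \<in> units_at f e"
  then show "\<exists>b\<in>units_at f e. b \<^bold>* a = e" unfolding units_at_def by blast
qed (auto simp: assoc units_at_def)

lemma group_subset_units_at:
  assumes "group \<lparr>carrier = K, monoid.mult = f, one = e\<rparr>"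
  shows "K \<subseteq> units_at f e"
proof
  let ?G = "\<lparr>carrier = K, monoid.mult = f, one = e\<rparr>"
  interpret group ?G by fact
  fix b assume "b \<in> K"
  then have "f e b = b" "f b e = b" "f e (inv\<^bsub>?G\<^esub> b) = inv\<^bsub>?G\<^esub> b"
    "f (inv\<^bsub>?G\<^esub> b) e = inv\<^bsub>?G\<^esub> b" "f b (inv\<^bsub>?G\<^esub> b) = e" "f (inv\<^bsub>?G\<^esub> b) b = e"
    using l_one[of b] r_one[of b] l_one[of "inv\<^bsub>?G\<^esub> b"] r_one[of "inv\<^bsub>?G\<^esub> b"] l_inv[of b] r_inv[of b] inv_closed[of b]
    by simp_all
  then show "b \<in> units_at f e" unfolding units_at_def by blast
qed

lemma (in semigroup) units_at_maximal:
  assumes "e \<^bold>* e = e"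
  shows "units_at f e \<in> maximal_subgroups f"
proof -
  have "K = units_at f e" if "is_subgroup f K" "units_at f e \<subseteq> K" for K
  proof -
    obtain e' where K: "group \<lparr>carrier = K, monoid.mult = f, one = e'\<rparr>"
      using \<open>is_subgroup f K\<close> by (auto simp: is_subgroup_def)
    then interpret group "\<lparr>carrier = K, monoid.mult = f, one = e'\<rparr>" .
    have "e \<in> K" using that(2) assms by (auto simp: units_at_def)
    \<comment> \<open>the only idempotent of a group is its identity\<close>
    then have "e = e'" using assms l_cancel_one by simp
    then show ?thesis using group_subset_units_at[OF K] that(2) by blast
  qed
  moreover have "is_subgroup f (units_at f e)"
    unfolding is_subgroup_def using group_units_at[OF assms] by blast
  ultimately show ?thesis unfolding maximal_subgroups_def by blast
qed

text \<open>
  One-sided inverses anywhere in the semigroup suffice: \<open>e r e\<close> and \<open>e l e\<close> are a right and a left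
  inverse of \<open>b\<close> in the monoid \<open>e S e\<close>, so they coincide.
\<close>

lemma (in semigroup) units_atI:
  assumes "e \<^bold>* e = e" "e \<^bold>* b = b" "b \<^bold>* e = b" "b \<^bold>* r = e" "l \<^bold>* b = e"
  shows "b \<in> units_at f e"
proof -
  let ?c = "e \<^bold>* r \<^bold>* e"
  have bc: "b \<^bold>* ?c = e" using assms by (metis assoc)
  have lb: "(e \<^bold>* l \<^bold>* e) \<^bold>* b = e" using assms by (metis assoc)
  have "?c = (e \<^bold>* l \<^bold>* e) \<^bold>* b \<^bold>* ?c" using assms lb by (metis assoc)
  also have "\<dots> = e \<^bold>* l \<^bold>* e" using bc assms by (metis assoc)
  finally have "?c \<^bold>* b = e" using lb by simp
  moreover have "e \<^bold>* ?c = ?c" "?c \<^bold>* e = ?c" using assms by (metis assoc)+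
  ultimately show ?thesis unfolding units_at_def using assms bc by blast
qed

section \<open>Green's relations\<close>

lemma (in semigroup) le_J_iff:
  "le_J f a b \<longleftrightarrow> a = b \<or> (\<exists>s. a = s \<^bold>* b) \<or> (\<exists>t. a = b \<^bold>* t) \<or> (\<exists>s t. a = s \<^bold>* b \<^bold>* t)"
  unfolding le_J_def S1_left_def S1_right_def by (auto simp: assoc)

lemma (in semigroup) le_J_trans: "le_J f a b \<Longrightarrow> le_J f b c \<Longrightarrow> le_J f a c"
  unfolding le_J_iff by (elim disjE exE; simp; metis assoc)

lemma (in semigroup) le_J_refl: "le_J f a a"
  and le_J_mult_left: "le_J f (s \<^bold>* a) a"
  and le_J_mult_right: "le_J f (a \<^bold>* s) a"
  unfolding le_J_iff by blast+

lemma (in semigroup) le_J_factor: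
  assumes "q \<noteq> []"
  shows "le_J f (word_value f \<phi> (p @ q @ r)) (word_value f \<phi> q)"
proof -
  have "le_J f (word_value f \<phi> (q @ r)) (word_value f \<phi> q)"
    using assms by (cases "r = []") (auto simp: word_value_append le_J_refl le_J_mult_right)
  moreover have "le_J f (word_value f \<phi> (p @ q @ r)) (word_value f \<phi> (q @ r))"
    using assms by (cases "p = []") (auto simp: word_value_append le_J_refl le_J_mult_left)
  ultimately show ?thesis using le_J_trans by blast
qed

lemma (in semigroup) le_R_trans: "le_R f a b \<Longrightarrow> le_R f b c \<Longrightarrow> le_R f a c"
  unfolding le_R_def S1_right_def by (auto simp: assoc)

lemma (in semigroup) le_L_trans: "le_L f a b \<Longrightarrow> le_L f b c \<Longrightarrow> le_L f a c"
  unfolding le_L_def S1_left_def by (auto simp: assoc[symmetric])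

text \<open>
  If \<open>a \<J> a z a\<close>, then both \<open>a z\<close> and \<open>z a\<close> lie between them in the \<open>\<J>\<close>-order. Hence stability
  applies to each of the four multiplications that lead from \<open>a\<close> to \<open>a z a\<close>.
\<close>

lemma (in semigroup) stable_sandwich:
  assumes "stable_semigroup f" "le_J f a (a \<^bold>* z \<^bold>* a)"
  shows "le_R f a (a \<^bold>* z \<^bold>* a)" "le_L f a (a \<^bold>* z \<^bold>* a)"
proof -
  have aza: "a \<^bold>* z \<^bold>* a = a \<^bold>* (z \<^bold>* a)" by (rule assoc)
  have below: "le_J f a (a \<^bold>* (z \<^bold>* a))" using assms(2) by (simp only: aza)
  have "le_J f a (a \<^bold>* z)" "le_J f a (z \<^bold>* a)"
    using le_J_trans[OF assms(2) le_J_mult_right] le_J_trans[OF below le_J_mult_left] .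
  moreover have "le_J f (a \<^bold>* z) (a \<^bold>* z \<^bold>* a)" "le_J f (z \<^bold>* a) (a \<^bold>* (z \<^bold>* a))"
    using le_J_trans[OF le_J_mult_right assms(2)] le_J_trans[OF le_J_mult_left below] .
  ultimately have "(a, a \<^bold>* z) \<in> green_J f" "(a \<^bold>* z, a \<^bold>* z \<^bold>* a) \<in> green_J f"
    "(a, z \<^bold>* a) \<in> green_J f" "(z \<^bold>* a, a \<^bold>* (z \<^bold>* a)) \<in> green_J f"
    by (simp_all add: green_J_def le_J_mult_left le_J_mult_right)
  then have "(a, a \<^bold>* z) \<in> green_R f" "(a \<^bold>* z, a \<^bold>* z \<^bold>* a) \<in> green_R f"
    "(a, z \<^bold>* a) \<in> green_L f" "(z \<^bold>* a, a \<^bold>* (z \<^bold>* a)) \<in> green_L f"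
    using assms(1) unfolding stable_semigroup_def by blast+
  then have *: "le_R f a (a \<^bold>* z)" "le_R f (a \<^bold>* z) (a \<^bold>* z \<^bold>* a)"
    "le_L f a (z \<^bold>* a)" "le_L f (z \<^bold>* a) (a \<^bold>* (z \<^bold>* a))"
    by (simp_all add: green_R_def green_L_def)
  show "le_R f a (a \<^bold>* z \<^bold>* a)" by (rule le_R_trans[OF *(1,2)])
  show "le_L f a (a \<^bold>* z \<^bold>* a)" unfolding aza by (rule le_L_trans[OF *(3,4)])
qed

text \<open>
  Stability yields \<open>a = a a x = y a a\<close> with \<open>x\<close> and \<open>y\<close> in the semigroup itself, since in the case
  \<open>a = a a\<close> the element \<open>a\<close> can serve as both. Then \<open>a x = y a a x = y a\<close> is an idempotent for which \<open>a\<close> has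
  the one-sided inverses \<open>x\<close> and \<open>y\<close>.
\<close>

lemma (in semigroup) stable_square:
  assumes "stable_semigroup f" "le_J f a (a \<^bold>* a)"
  obtains e where "e \<^bold>* e = e" "a \<in> units_at f e"
proof -
  have "(a, a \<^bold>* a) \<in> green_J f"
    using assms(2) le_J_mult_left unfolding green_J_def by blast
  then have "(a, a \<^bold>* a) \<in> green_R f" "(a, a \<^bold>* a) \<in> green_L f"
    using assms(1) unfolding stable_semigroup_def by blast+
  then obtain x y where x: "a = a \<^bold>* a \<^bold>* x" and y: "a = y \<^bold>* a \<^bold>* a"
    unfolding green_R_def green_L_def le_R_def le_L_def S1_left_def S1_right_def
    by (auto simp: assoc) metis+
  define e where "e = a \<^bold>* x"
  have e': "e = y \<^bold>* a" unfolding e_def using x y by (metis assoc)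
  have "e \<^bold>* e = e" "e \<^bold>* a = a" "a \<^bold>* e = a" using x y e' e_def by (metis assoc)+
  then show ?thesis using that units_atI e' e_def by metis
qed

text \<open>
  With \<open>b = a z a\<close>, stability yields \<open>a = b p = q b\<close>, so multiplication with the inverse of \<open>a\<close>
  yields one-sided inverses of \<open>b\<close>.
\<close>

lemma (in semigroup) sandwich_in_units_at:
  assumes "stable_semigroup f" "e \<^bold>* e = e" "a \<in> units_at f e" "le_J f a (a \<^bold>* z \<^bold>* a)"
  shows "a \<^bold>* z \<^bold>* a \<in> units_at f e"
proof -
  let ?b = "a \<^bold>* z \<^bold>* a"
  obtain c where c: "e \<^bold>* a = a" "a \<^bold>* e = a" "e \<^bold>* c = c" "c \<^bold>* e = c" "a \<^bold>* c = e" "c \<^bold>* a = e"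
    using assms(3) by (auto simp: units_at_def)
  have be: "e \<^bold>* ?b = ?b" "?b \<^bold>* e = ?b" using c by (metis assoc)+
  have "a = ?b \<or> (\<exists>p. a = ?b \<^bold>* p)"
    using stable_sandwich(1)[OF assms(1,4)] unfolding le_R_def S1_right_def by blast
  then obtain p where "a = ?b \<^bold>* p" using be(2) by metis
  then have p: "?b \<^bold>* (p \<^bold>* c) = e" using c by (metis assoc)
  have "a = ?b \<or> (\<exists>q. a = q \<^bold>* ?b)"
    using stable_sandwich(2)[OF assms(1,4)] unfolding le_L_def S1_left_def by blast
  then obtain q where "a = q \<^bold>* ?b" using be(1) by metis
  then have "(c \<^bold>* q) \<^bold>* ?b = e" using c by (metis assoc)
  then show ?thesis using units_atI[OF assms(2) be p] by blast
qed

text \<open>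
  Two of the \<open>k + 1\<close> elements \<open>T 0, \<dots>, T k\<close> share a \<open>\<J>\<close>-class, and then so does everything that the
  descending chain visits in between.
\<close>

lemma (in semigroup) J_chain_stabilizes:
  assumes "finite (UNIV // green_J f)" "\<And>j. le_J f (T (Suc j)) (T j)"
  obtains j where "j < card (UNIV // green_J f)" "le_J f (T j) (T (Suc j))"
proof -
  let ?c = "\<lambda>j. green_J f `` {T j}" and ?k = "card (UNIV // green_J f)"
  have anti: "le_J f (T j) (T i)" if "i \<le> j" for i j
    using that by (induction j rule: dec_induct) (use le_J_refl le_J_trans assms(2) in blast)+
  have "?c ` {..?k} \<subseteq> UNIV // green_J f" by (auto simp: quotient_def)
  then have "card (?c ` {..?k}) \<le> ?k" by (rule card_mono[OF assms(1)])
  then have "\<not> inj_on ?c {..?k}" using pigeonhole[of ?c "{..?k}"] by simp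
  then obtain i j where ij: "i < j" "j \<le> ?k" "?c i = ?c j"
    unfolding inj_on_def by (metis atMost_iff linorder_neqE_nat)
  have "T j \<in> ?c j" by (auto simp: green_J_def le_J_refl)
  then have "le_J f (T i) (T j)" using ij(3) by (auto simp: green_J_def)
  moreover have "le_J f (T j) (T (Suc i))" using anti ij(1) by simp
  ultimately show ?thesis using that[of i] ij le_J_trans by (meson less_le_trans)
qed

text \<open>
  The subgroup depends on \<open>\<phi>\<close>, and so does the number of iterations after which the values enter it. But they
  never leave it again, which is why the number of \<open>\<J>\<close>-classes is enough for all \<open>\<phi>\<close>.
\<close>

lemma (in semigroup) iterated_advance_in_maximal_subgroup:
  assumes "stable_semigroup f" "finite (UNIV // green_J f)" "w \<noteq> []" "0 \<notin> set w"
  obtains H where "H \<in> maximal_subgroups f"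
    and "\<And>x. x \<in> set w \<Longrightarrow> (advance f w ^^ card (UNIV // green_J f)) \<phi> x \<in> H"
proof -
  let ?k = "card (UNIV // green_J f)"
  define \<psi> where "\<psi> j = (advance f w ^^ j) \<phi>" for j
  have \<psi>_Suc: "\<psi> (Suc j) = advance f w (\<psi> j)" for j by (simp add: \<psi>_def)
  have "le_J f (\<psi> (Suc j) 0) (\<psi> j 0)" for j
    using advance_zero[OF assms(3,4)] le_J_mult_right by (simp add: \<psi>_Suc)
  then obtain j where j: "j < ?k" "le_J f (\<psi> j 0) (\<psi> (Suc j) 0)"
    using J_chain_stabilizes[OF assms(2), of "\<lambda>j. \<psi> j 0"] by blast
  define a where "a = \<psi> j 0"
  have factor: "le_J f a (word_value f (\<psi> j) q)" if "mix w 0 = p @ q @ r" "q \<noteq> []" for p q r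
    using j(2) le_J_factor[OF that(2), of "\<psi> j" p r] that(1) le_J_trans
    by (simp add: a_def \<psi>_Suc advance_def)
  \<comment> \<open>the image of \<open>0\<close> starts with \<open>0 0\<close>, so \<open>a a\<close> is a factor of the next value of \<open>0\<close>\<close>
  obtain x xs where "w = x # xs" using assms(3) by (cases w) auto
  then have "mix w 0 = [] @ [0, 0] @ (x # 0 # concat (map (\<lambda>z. [0, z, 0]) xs))"
    by (simp add: mix_def)
  then have "le_J f a (a \<^bold>* a)" using factor[of "[]" "[0, 0]"] by (simp add: a_def)
  then obtain e where e: "e \<^bold>* e = e" "a \<in> units_at f e"
    using stable_square[OF assms(1)] by blast
  let ?H = "units_at f e"
  have sandwich: "\<psi> (Suc j) z \<in> ?H" if z: "z \<in> set w" for z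
  proof -
    have "z \<noteq> 0" using z assms(4) by metis
    obtain ys zs where "w = ys @ z # zs" using split_list[OF z] by blast
    then have "mix w 0 = (0 # concat (map (\<lambda>z. [0, z, 0]) ys)) @ [0, z, 0] @
        concat (map (\<lambda>z. [0, z, 0]) zs)"
      by (simp add: mix_def)
    then have "le_J f a (word_value f (\<psi> j) [0, z, 0])" by (rule factor) simp
    then have "le_J f a (a \<^bold>* \<psi> j z \<^bold>* a)" by (simp add: a_def assoc)
    then have "a \<^bold>* \<psi> j z \<^bold>* a \<in> ?H" using sandwich_in_units_at[OF assms(1) e] by blast
    then show ?thesis using \<open>z \<noteq> 0\<close> by (simp add: \<psi>_Suc advance_nonzero a_def)
  qed
  interpret group "\<lparr>carrier = ?H, monoid.mult = f, one = e\<rparr>" by (rule group_units_at[OF e(1)])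
  have closed: "b \<^bold>* c \<in> ?H" if "b \<in> ?H" "c \<in> ?H" for b c using m_closed that by simp
  have "word_value f (\<psi> (Suc j)) w \<in> ?H"
    by (rule word_value_closed[OF assms(3)]) (use sandwich closed in auto)
  then have "\<psi> (Suc j) 0 \<in> ?H"
    using closed[OF e(2)] advance_zero[OF assms(3,4)] by (simp add: \<psi>_Suc a_def)
  then have start: "\<forall>z \<in> insert 0 (set w). \<psi> (Suc j) z \<in> ?H" using sandwich by simp
  have "\<forall>z \<in> insert 0 (set w). \<psi> m z \<in> ?H" if "Suc j \<le> m" for m
    using that
  proof (induction m rule: dec_induct)
    case base
    then show ?case using start .
  next
    case (step m)
    then show ?case unfolding \<psi>_Suc using advance_closed[OF closed assms(3,4)] by blast
  qed
  then have "\<forall>z \<in> set w. \<psi> ?k z \<in> ?H" using j(1) by simp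
  then show ?thesis using that[OF units_at_maximal[OF e(1)]] by (simp add: \<psi>_def)
qed

section \<open>Identities in products of groups\<close>

lemma maximal_subgroupsE:
  assumes "H \<in> maximal_subgroups f"
  obtains e where "group \<lparr>carrier = H, monoid.mult = f, one = e\<rparr>"
  using assms by (auto simp: maximal_subgroups_def is_subgroup_def)

lemma maximal_subgroup_mult_closed:
  assumes "H \<in> maximal_subgroups f" "a \<in> H" "b \<in> H"
  shows "f a b \<in> H"
proof -
  obtain e where "group \<lparr>carrier = H, monoid.mult = f, one = e\<rparr>"
    using maximal_subgroupsE[OF assms(1)] .
  then interpret group "\<lparr>carrier = H, monoid.mult = f, one = e\<rparr>" .
  show ?thesis using m_closed assms(2,3) by simp
qed

lemma maximal_subgroup_nonempty:
  assumes "H \<in> maximal_subgroups f"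
  shows "H \<noteq> {}"
proof -
  obtain e where "group \<lparr>carrier = H, monoid.mult = f, one = e\<rparr>"
    using maximal_subgroupsE[OF assms] .
  then interpret group "\<lparr>carrier = H, monoid.mult = f, one = e\<rparr>" .
  show ?thesis using one_closed by auto
qed

lemma word_value_product:
  assumes "w \<noteq> []" "i \<in> I"
  shows "word_value (monoid.mult (product_group I G)) \<phi> w i = word_value (monoid.mult (G i)) (\<lambda>x. \<phi> x i) w"
  using assms(1)
  by (induction w rule: list_nonempty_induct) (auto simp: word_value_Cons assms(2))

text \<open>
  A failure of the identity in one factor lifts to the product by choosing arbitrary elements of the other
  factors.
\<close>

lemma satisfies_maximal_subgroups_product_iff:
  fixes f :: "'a \<Rightarrow> 'a \<Rightarrow> 'a"
  assumes "u \<noteq> []" "v \<noteq> []"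
  defines "G \<equiv> maximal_subgroups_product f"
  shows "satisfies (carrier G) (monoid.mult G) (u, v) \<longleftrightarrow>
    (\<forall>H \<in> maximal_subgroups f. satisfies H f (u, v))"
proof
  have G: "carrier G = (\<Pi>\<^sub>E H \<in> maximal_subgroups f. H)"
    by (simp add: G_def maximal_subgroups_product_def subgroup_of_def)
  have component: "word_value (monoid.mult G) \<phi> w H = word_value f (\<lambda>x. \<phi> x H) w"
    if "w \<noteq> []" "H \<in> maximal_subgroups f" for \<phi> w H
    using word_value_product[OF that, of "subgroup_of f"]
    by (simp add: G_def maximal_subgroups_product_def subgroup_of_def)
  {
    assume sat: "\<forall>H \<in> maximal_subgroups f. satisfies H f (u, v)"
    show "satisfies (carrier G) (monoid.mult G) (u, v)"
      unfolding satisfies_def prod.case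
    proof
      fix \<phi> assume \<phi>: "\<phi> \<in> set (u @ v) \<rightarrow> carrier G"
      have closedG: "a \<otimes>\<^bsub>G\<^esub> b \<in> carrier G" if "a \<in> carrier G" "b \<in> carrier G" for a b
        using that unfolding G
        by (auto intro: maximal_subgroup_mult_closed simp: G_def maximal_subgroups_product_def subgroup_of_def PiE_def Pi_def)
      have in_G: "word_value (monoid.mult G) \<phi> u \<in> carrier G"
        "word_value (monoid.mult G) \<phi> v \<in> carrier G"
        by (rule word_value_closed; use assms \<phi> closedG in auto)+
      show "word_value (monoid.mult G) \<phi> u = word_value (monoid.mult G) \<phi> v"
      proof (rule PiE_ext[OF in_G[unfolded G]])
        fix H assume H: "H \<in> maximal_subgroups f"
        then have "(\<lambda>x. \<phi> x H) \<in> set (u @ v) \<rightarrow> H" using \<phi> by (auto simp: G)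
        then have "word_value f (\<lambda>x. \<phi> x H) u = word_value f (\<lambda>x. \<phi> x H) v"
          using sat H by (auto simp: satisfies_def)
        then show "word_value (monoid.mult G) \<phi> u H = word_value (monoid.mult G) \<phi> v H"
          using component assms H by simp
      qed
    qed
  next
    assume sat: "satisfies (carrier G) (monoid.mult G) (u, v)"
    show "\<forall>H \<in> maximal_subgroups f. satisfies H f (u, v)"
    proof
      fix H assume H: "H \<in> maximal_subgroups f"
      obtain c where c: "\<And>K. K \<in> maximal_subgroups f \<Longrightarrow> c K \<in> K"
        using maximal_subgroup_nonempty by (metis ex_in_conv)
      show "satisfies H f (u, v)"
        unfolding satisfies_def prod.case
      proof
        fix \<phi> assume \<phi>: "\<phi> \<in> set (u @ v) \<rightarrow> H"
        define \<Phi> where "\<Phi> x = (\<lambda>K \<in> maximal_subgroups f. if K = H then \<phi> x else c K)" for x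
        have "\<Phi> \<in> set (u @ v) \<rightarrow> carrier G" using \<phi> c by (auto simp: G \<Phi>_def)
        then have "word_value (monoid.mult G) \<Phi> u H = word_value (monoid.mult G) \<Phi> v H"
          using sat unfolding satisfies_def by auto
        then show "word_value f \<phi> u = word_value f \<phi> v"
          using component assms H by (simp add: \<Phi>_def)
      qed
    qed
  }
qed

section \<open>Programs that print iterated substitutions\<close>

lemma exec_time: "exec p s t s' \<Longrightarrow> t = t' \<Longrightarrow> exec p s t' s'"
  by simp

lemma exec_InstrI: "s' = step c s \<Longrightarrow> exec (Instr c) s 1 s'"
  by (simp only: exec_Instr)

text \<open>
  Registers \<open>0\<close> and \<open>1\<close> hold the constants \<open>0\<close> and \<open>1\<close> throughout, registers from \<open>2\<close> on are loop
  variables, and the input words are stored at an address \<open>a\<close> above all of these. A program that uses the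
  loop variables below \<open>m\<close> leaves a state related to the initial one as follows.
\<close>

definition agree_outside :: "nat \<Rightarrow> (nat \<Rightarrow> nat) \<Rightarrow> (nat \<Rightarrow> nat) \<Rightarrow> bool" where
  "agree_outside m X Y \<longleftrightarrow> (\<forall>a. a \<notin> {2..<m} \<longrightarrow> Y a = X a)"

lemma agree_outside_refl: "agree_outside m X X"
  by (simp add: agree_outside_def)

lemma agree_outside_trans:
  "agree_outside m X Y \<Longrightarrow> agree_outside m' Y Z \<Longrightarrow> m \<le> n \<Longrightarrow> m' \<le> n \<Longrightarrow> agree_outside n X Z"
  by (auto simp: agree_outside_def)

definition loop_body :: "nat \<Rightarrow> prog \<Rightarrow> prog" where
  "loop_body i p = Seq p (Seq (Instr (Add i i 1)) (Instr (Load (i + 1) i)))"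

text \<open>
  The array is zero-terminated and starts at the address that register \<open>i\<close> holds initially. The
  body \<open>p\<close> finds the address of the current entry in register \<open>i\<close> and the entry itself in register \<open>i + 1\<close>.
\<close>

definition for_each :: "nat \<Rightarrow> prog \<Rightarrow> prog" where
  "for_each i p = Seq (Instr (Load (i + 1) i)) (While (i + 1) (loop_body i p))"

text \<open>
  The array is described by its contents in a reference state \<open>X0\<close>, from which the current state differs
  in the loop variables only. The set \<open>C\<close> lets the induction shrink the array while the entries for which the
  body is known to work stay the same.
\<close>

lemma exec_for_each_loop:
  assumes body: "\<And>X out. agree_outside (i + 2) X0 X \<Longrightarrow> X (i + 1) \<in> C \<Longrightarrow>
      \<exists>Y. exec p (X, inp, out) t (Y, inp, out @ g (X (i + 1))) \<and> agree_outside i X Y"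
    and X0: "X0 1 = 1" and "2 \<le> i"
  shows "\<forall>l < length cs. X0 (a + l) = cs ! l \<Longrightarrow> X0 (a + length cs) = 0 \<Longrightarrow>
    0 \<notin> set cs \<Longrightarrow> set cs \<subseteq> C \<Longrightarrow> i + 2 \<le> a \<Longrightarrow>
    agree_outside (i + 2) X0 X \<Longrightarrow> X i = a \<Longrightarrow> X (i + 1) = X0 a \<Longrightarrow>
    \<exists>Y. exec (While (i + 1) (loop_body i p)) (X, inp, out) (1 + length cs * (t + 3))
          (Y, inp, out @ concat (map g cs)) \<and>
        agree_outside (i + 2) X0 Y \<and> Y i = a + length cs"
proof (induction cs arbitrary: a X out)
  case Nil
  then show ?case
    using exec_WhileFalse[of "(X, inp, out)" "i + 1" "loop_body i p"] by auto
next
  case (Cons c cs)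
  have c: "X (i + 1) = c" "c > 0" "c \<in> C" using Cons.prems by auto
  obtain Y where Y: "exec p (X, inp, out) t (Y, inp, out @ g c)" "agree_outside i X Y"
    using body[OF Cons.prems(6)] c by auto
  define Z where "Z = Y(i := a + 1, i + 1 := X0 (a + 1))"
  have Yi: "Y i = a" "Y 1 = 1" "Y (a + 1) = X0 (a + 1)"
    using Y(2) Cons.prems(5-7) X0 \<open>2 \<le> i\<close> by (auto simp: agree_outside_def)
  have "exec (loop_body i p) (X, inp, out) (t + (1 + 1)) (Z, inp, out @ g c)"
    unfolding loop_body_def
    by (rule exec_Seq[OF Y(1)], rule exec_Seq; rule exec_InstrI)
      (use Yi Cons.prems(5) in \<open>auto simp: Z_def\<close>)
  moreover obtain Y' where Y': "exec (While (i + 1) (loop_body i p)) (Z, inp, out @ g c)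
      (1 + length cs * (t + 3)) (Y', inp, (out @ g c) @ concat (map g cs))"
    "agree_outside (i + 2) X0 Y'" "Y' i = a + 1 + length cs"
  proof -
    have "\<forall>l < length cs. X0 (a + 1 + l) = cs ! l" using Cons.prems(1) by auto
    moreover have Z: "Z i = a + 1" "Z (i + 1) = X0 (a + 1)" by (simp_all add: Z_def)
    moreover have "agree_outside (i + 2) X0 Z"
      using Cons.prems(6) Y(2) \<open>2 \<le> i\<close> by (auto simp: Z_def agree_outside_def)
    ultimately have "\<exists>Y. exec (While (i + 1) (loop_body i p)) (Z, inp, out @ g c)
        (1 + length cs * (t + 3)) (Y, inp, (out @ g c) @ concat (map g cs)) \<and>
        agree_outside (i + 2) X0 Y \<and> Y i = a + 1 + length cs"
      using Cons.prems(2-5) by (intro Cons.IH) (auto simp: Z)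
    then show ?thesis using that by blast
  qed
  ultimately have "exec (While (i + 1) (loop_body i p)) (X, inp, out)
      ((t + (1 + 1)) + (1 + length cs * (t + 3)) + 1) (Y', inp, (out @ g c) @ concat (map g cs))"
    using c by (intro exec_WhileTrue) auto
  then show ?case using Y'(2,3) by (auto elim!: exec_time intro!: exI[of _ Y'])
qed

lemma exec_for_each:
  assumes body: "\<And>X out. agree_outside (i + 2) X0 X \<Longrightarrow> X (i + 1) \<in> set cs \<Longrightarrow>
      \<exists>Y. exec p (X, inp, out) t (Y, inp, out @ g (X (i + 1))) \<and> agree_outside i X Y"
    and X0: "X0 1 = 1" and "2 \<le> i" "i + 2 \<le> a"
    and cs: "\<forall>l < length cs. X0 (a + l) = cs ! l" "X0 (a + length cs) = 0" "0 \<notin> set cs"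
    and X: "agree_outside (i + 2) X0 X" "X i = a"
  shows "\<exists>Y. exec (for_each i p) (X, inp, out) (2 + length cs * (t + 3))
      (Y, inp, out @ concat (map g cs)) \<and> agree_outside (i + 2) X0 Y \<and> Y i = a + length cs"
proof -
  define Z where "Z = X(i + 1 := X0 a)"
  have "agree_outside (i + 2) X0 Z" "Z i = a" "Z (i + 1) = X0 a"
    using X \<open>2 \<le> i\<close> by (auto simp: Z_def agree_outside_def)
  then obtain Y where Y: "exec (While (i + 1) (loop_body i p)) (Z, inp, out) (1 + length cs * (t + 3))
      (Y, inp, out @ concat (map g cs))" "agree_outside (i + 2) X0 Y" "Y i = a + length cs"
    using exec_for_each_loop[where C = "set cs" and g = g and X = Z, OF body X0 \<open>2 \<le> i\<close> cs subset_refl \<open>i + 2 \<le> a\<close>]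
    by blast
  have "exec (Instr (Load (i + 1) i)) (X, inp, out) 1 (Z, inp, out)"
    by (rule exec_InstrI) (use X \<open>2 \<le> i\<close> \<open>i + 2 \<le> a\<close> in \<open>auto simp: Z_def agree_outside_def\<close>)
  then have "exec (for_each i p) (X, inp, out) (1 + (1 + length cs * (t + 3)))
      (Y, inp, out @ concat (map g cs))"
    unfolding for_each_def by (rule exec_Seq) (rule Y(1))
  then show ?thesis using Y(2,3) by (auto elim!: exec_time intro!: exI[of _ Y])
qed

text \<open>
  The two words of an identity are stored one after the other in their encoding, each with its terminating
  zero. The instruction \<open>sep\<close> is executed after each of them.
\<close>

definition for_words :: "nat \<Rightarrow> nat \<Rightarrow> instr \<Rightarrow> prog \<Rightarrow> prog" where
  "for_words i a sep p = Seq (Instr (Const i a)) (Seq (for_each i p) (Seq (Instr sep)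
     (Seq (Instr (Add i i 1)) (Seq (for_each i p) (Instr sep)))))"

definition stores :: "nat \<Rightarrow> identity \<Rightarrow> (nat \<Rightarrow> nat) \<Rightarrow> bool" where
  "stores a i X \<longleftrightarrow> X 0 = 0 \<and> X 1 = 1 \<and> (\<forall>l < length (encode i). X (a + l) = encode i ! l)"

lemma stores_agree_outside: "stores a i X \<Longrightarrow> agree_outside m X Y \<Longrightarrow> m \<le> a \<Longrightarrow> stores a i Y"
  by (auto simp: stores_def agree_outside_def)

lemma exec_for_words:
  assumes body: "\<And>X out. agree_outside (i + 2) X0 X \<Longrightarrow> X (i + 1) \<in> Suc ` set (u @ v) \<Longrightarrow>
      \<exists>Y. exec p (X, inp, out) t (Y, inp, out @ g (X (i + 1))) \<and> agree_outside i X Y"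
    and stores: "stores a (u, v) X0" and i: "2 \<le> i" "i + 2 \<le> a"
    and sep: "\<And>X out. X 0 = 0 \<Longrightarrow> step sep (X, inp, out) = (X, inp, out @ s)"
  shows "\<exists>Y. exec (for_words i a sep p) (X0, inp, out) (8 + length (u @ v) * (t + 3))
      (Y, inp, out @ concat (map (g \<circ> Suc) u) @ s @ concat (map (g \<circ> Suc) v) @ s) \<and>
      agree_outside (i + 2) X0 Y"
proof -
  let ?u = "map Suc u" and ?v = "map Suc v"
  have X0: "X0 0 = 0" "X0 1 = 1" using stores by (auto simp: stores_def)
  have stored: "X0 (a + l) = (?u @ 0 # ?v @ [0]) ! l" if "l < length u + length v + 2" for l
    using stores that by (auto simp: stores_def encode_def)
  have u: "\<forall>l < length ?u. X0 (a + l) = ?u ! l" "X0 (a + length ?u) = 0"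
    using stored by (auto simp: nth_append)
  let ?b = "a + length u + 1"
  have v: "\<forall>l < length ?v. X0 (?b + l) = ?v ! l" "X0 (?b + length ?v) = 0"
  proof -
    have "X0 (?b + l) = (?v @ [0]) ! l" if "l < length v + 1" for l
      using stored[of "length u + 1 + l"] that by (simp add: nth_append ac_simps)
    then show "\<forall>l < length ?v. X0 (?b + l) = ?v ! l" "X0 (?b + length ?v) = 0"
      by (auto simp: nth_append)
  qed
  have in_u: "z \<in> set ?u \<Longrightarrow> z \<in> Suc ` set (u @ v)" and in_v: "z \<in> set ?v \<Longrightarrow> z \<in> Suc ` set (u @ v)"
    for z by auto
  let ?out1 = "out @ concat (map g ?u)" and ?out2 = "(out @ concat (map g ?u)) @ s"
  let ?out3 = "((out @ concat (map g ?u)) @ s) @ concat (map g ?v)"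
  define X1 where "X1 = X0(i := a)"
  have X1: "agree_outside (i + 2) X0 X1" "X1 i = a"
    using i by (auto simp: X1_def agree_outside_def)
  have "\<exists>Y. exec (for_each i p) (X1, inp, out) (2 + length ?u * (t + 3)) (Y, inp, ?out1) \<and>
      agree_outside (i + 2) X0 Y \<and> Y i = a + length ?u"
    by (rule exec_for_each[OF body[OF _ in_u] X0(2) i u _ X1]) auto
  then obtain Y where Y: "exec (for_each i p) (X1, inp, out) (2 + length ?u * (t + 3)) (Y, inp, ?out1)"
    "agree_outside (i + 2) X0 Y" "Y i = a + length ?u"
    by blast
  define Y1 where "Y1 = Y(i := ?b)"
  have Y1: "agree_outside (i + 2) X0 Y1" "Y1 i = ?b"
    using Y(2) i by (auto simp: Y1_def agree_outside_def)
  have ib: "i + 2 \<le> ?b" using i by simp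
  have "\<exists>Z. exec (for_each i p) (Y1, inp, ?out2) (2 + length ?v * (t + 3)) (Z, inp, ?out3) \<and>
      agree_outside (i + 2) X0 Z \<and> Z i = ?b + length ?v"
    by (rule exec_for_each[OF body[OF _ in_v] X0(2) i(1) ib v _ Y1]) auto
  then obtain Z where Z: "exec (for_each i p) (Y1, inp, ?out2) (2 + length ?v * (t + 3)) (Z, inp, ?out3)"
    "agree_outside (i + 2) X0 Z"
    by blast
  have registers: "Y 0 = 0" "Y 1 = 1" "Z 0 = 0"
    using Y(2) Z(2) X0 by (auto simp: agree_outside_def)
  have "exec (for_words i a sep p) (X0, inp, out)
      (1 + ((2 + length ?u * (t + 3)) + (1 + (1 + ((2 + length ?v * (t + 3)) + 1)))))
      (Z, inp, ?out3 @ s)"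
    unfolding for_words_def
  proof (intro exec_Seq)
    show "exec (Instr (Const i a)) (X0, inp, out) 1 (X1, inp, out)"
      by (rule exec_InstrI) (simp add: X1_def)
    show "exec (Instr sep) (Y, inp, ?out1) 1 (Y, inp, ?out2)"
      by (rule exec_InstrI) (simp add: sep registers)
    show "exec (Instr (Add i i 1)) (Y, inp, ?out2) 1 (Y1, inp, ?out2)"
      by (rule exec_InstrI) (use Y(3) registers in \<open>simp add: Y1_def\<close>)
    show "exec (Instr sep) (Z, inp, ?out3) 1 (Z, inp, ?out3 @ s)"
      by (rule exec_InstrI) (simp add: sep registers)
  qed (rule Y(1) Z(1))+
  moreover have "1 + ((2 + length ?u * (t + 3)) + (1 + (1 + ((2 + length ?v * (t + 3)) + 1)))) =
      8 + length (u @ v) * (t + 3)"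
    by (simp add: algebra_simps)
  ultimately have "exec (for_words i a sep p) (X0, inp, out) (8 + length (u @ v) * (t + 3))
      (Z, inp, ?out3 @ s)"
    by metis
  then show ?thesis using Z(2) by auto
qed

definition sandwich :: "prog \<Rightarrow> prog \<Rightarrow> prog" where
  "sandwich p q = Seq p (Seq q p)"

text \<open>
  \<open>emit a j r\<close> prints the \<open>j\<close>-fold substitution into the letter whose code is in register \<open>r\<close>. Register \<open>1\<close>
  always holds \<open>1\<close>, the code of the letter \<open>0\<close>, so \<open>r = 1\<close> identifies this letter already when the
  program is built. The recursion unfolds into a fixed program in which level \<open>j\<close> has its own loop variables
  \<open>2j + 2\<close> and \<open>2j + 3\<close>; no call stack is needed. The separator \<open>Sub 0 0 0\<close> has no effect, as register \<open>0\<close> holds \<open>0\<close>.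
\<close>

primrec emit :: "nat \<Rightarrow> nat \<Rightarrow> nat \<Rightarrow> prog" where
  "emit a 0 r = Instr (Print r)"
| "emit a (Suc j) r =
     (if r = 1 then Seq (emit a j 1)
        (for_words (2 * j + 2) a (Sub 0 0 0) (sandwich (emit a j 1) (emit a j (2 * j + 3))))
      else sandwich (emit a j 1) (emit a j r))"

primrec emit_time :: "nat \<Rightarrow> bool \<Rightarrow> nat poly" where
  "emit_time 0 zero = 1"
| "emit_time (Suc j) zero =
     (let sandwich_time = emit_time j True + (emit_time j False + emit_time j True)
      in if zero then emit_time j True + ([:8:] + [:0, 1:] * (sandwich_time + [:3:]))
         else sandwich_time)"

text \<open>
  The polynomials \<^const>\<open>emit_time\<close> are evaluated at the number of letter occurrences and yield the exact
  running time, which keeps the induction free of inequalities.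
\<close>

lemma exec_emit:
  assumes "0 \<notin> set (u @ v)"
  shows "stores a (u, v) X \<Longrightarrow> 2 * j + 2 \<le> a \<Longrightarrow> X r = Suc x \<Longrightarrow>
    r = 1 \<or> 2 * j + 2 \<le> r \<and> x \<noteq> 0 \<Longrightarrow>
    \<exists>Y. exec (emit a j r) (X, inp, out) (poly (emit_time j (r = 1)) (length (u @ v)))
          (Y, inp, out @ map Suc (iterated_mix (u @ v) j x)) \<and> agree_outside (2 * j + 2) X Y"
proof (induction j arbitrary: X r x out)
  case 0
  then show ?case using exec_Instr[of "Print r" "(X, inp, out)"] agree_outside_refl by auto
next
  case (Suc j)
  let ?w = "u @ v" and ?n = "length (u @ v)"
  let ?I = "\<lambda>x. map Suc (iterated_mix (u @ v) j x)"
  let ?p = "emit a j 1" and ?tp = "poly (emit_time j True) (length (u @ v))"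
  let ?tq = "poly (emit_time j False) (length (u @ v))"
  have p: "\<exists>Y. exec ?p (X, inp, out) ?tp (Y, inp, out @ ?I 0) \<and> agree_outside (2 * j + 2) X Y"
    if "stores a (u, v) X" for X out
    using Suc.IH[OF that, of 1 0 out] Suc.prems(2) that by (auto simp: stores_def)
  have sandwich: "\<exists>Y. exec (sandwich ?p (emit a j r)) (X, inp, out) (?tp + (?tq + ?tp))
      (Y, inp, out @ ?I 0 @ ?I x @ ?I 0) \<and> agree_outside (2 * j + 2) X Y"
    if X: "stores a (u, v) X" and r: "2 * j + 2 \<le> r" "X r = Suc x" "x \<noteq> 0" for X r x out
  proof -
    obtain Y1 where Y1: "exec ?p (X, inp, out) ?tp (Y1, inp, out @ ?I 0)"
      "agree_outside (2 * j + 2) X Y1"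
      using p[OF X] by blast
    have s1: "stores a (u, v) Y1" using stores_agree_outside[OF X Y1(2)] Suc.prems(2) by simp
    have "Y1 r = Suc x" using Y1(2) r by (auto simp: agree_outside_def)
    then obtain Y2 where Y2: "exec (emit a j r) (Y1, inp, out @ ?I 0) ?tq (Y2, inp, (out @ ?I 0) @ ?I x)"
      "agree_outside (2 * j + 2) Y1 Y2"
      using Suc.IH[OF s1, of r x "out @ ?I 0"] Suc.prems(2) r by auto
    have "stores a (u, v) Y2" using stores_agree_outside[OF s1 Y2(2)] Suc.prems(2) by simp
    then obtain Y3 where Y3: "exec ?p (Y2, inp, (out @ ?I 0) @ ?I x) ?tp
        (Y3, inp, ((out @ ?I 0) @ ?I x) @ ?I 0)" "agree_outside (2 * j + 2) Y2 Y3"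
      using p by blast
    have "agree_outside (2 * j + 2) X Y3"
      using Y1(2) Y2(2) Y3(2) by (meson agree_outside_trans order_refl)
    moreover have "exec (sandwich ?p (emit a j r)) (X, inp, out) (?tp + (?tq + ?tp))
        (Y3, inp, ((out @ ?I 0) @ ?I x) @ ?I 0)"
      unfolding sandwich_def by (intro exec_Seq) (rule Y1(1) Y2(1) Y3(1))+
    ultimately show ?thesis by auto
  qed
  show ?case
  proof (cases "r = 1")
    case False
    then have "2 * j + 2 \<le> r" "x \<noteq> 0" using Suc.prems(4) by auto
    moreover have "map Suc (iterated_mix ?w (Suc j) x) = ?I 0 @ ?I x @ ?I 0"
      using \<open>x \<noteq> 0\<close> by (simp add: iterated_mix_nonzero del: iterated_mix.simps)
    ultimately show ?thesis
      using sandwich[OF Suc.prems(1) _ Suc.prems(3)] False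
      by (fastforce simp: Let_def agree_outside_def)
  next
    case True
    then have x: "x = 0" using Suc.prems(1,3) by (simp add: stores_def)
    let ?g = "\<lambda>c. ?I 0 @ ?I (c - 1) @ ?I 0"
    let ?i = "2 * j + 2"
    obtain Y where Y: "exec ?p (X, inp, out) ?tp (Y, inp, out @ ?I 0)" "agree_outside ?i X Y"
      using p[OF Suc.prems(1)] by blast
    have sY: "stores a (u, v) Y" using stores_agree_outside[OF Suc.prems(1) Y(2)] Suc.prems(2) by simp
    have body: "\<exists>Z'. exec (sandwich ?p (emit a j (2 * j + 3))) (Z, inp, out') (?tp + (?tq + ?tp))
        (Z', inp, out' @ ?g (Z (?i + 1))) \<and> agree_outside ?i Z Z'"
      if Z: "agree_outside (?i + 2) Y Z" "Z (?i + 1) \<in> Suc ` set (u @ v)" for Z out'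
    proof -
      obtain z where z: "Z (2 * j + 3) = Suc z" "z \<in> set (u @ v)"
        using Z(2) by (auto simp: numeral_3_eq_3)
      then have "z \<noteq> 0" using assms by metis
      moreover have "stores a (u, v) Z" using stores_agree_outside[OF sY Z(1)] Suc.prems(2) by simp
      moreover have "Z (?i + 1) = Suc z" using z(1) by (simp add: numeral_3_eq_3)
      ultimately show ?thesis using sandwich[of Z "2 * j + 3" z out'] z(1)
        by (simp only: diff_Suc_1) simp
    qed
    have "\<exists>Z. exec (for_words ?i a (Sub 0 0 0) (sandwich ?p (emit a j (2 * j + 3))))
        (Y, inp, out @ ?I 0) (8 + ?n * (?tp + (?tq + ?tp) + 3))
        (Z, inp, (out @ ?I 0) @ concat (map (?g \<circ> Suc) u) @ [] @ concat (map (?g \<circ> Suc) v) @ []) \<and>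
        agree_outside (?i + 2) Y Z"
      by (rule exec_for_words[OF body sY]) (use Suc.prems(2) in auto)
    then obtain Z where Z: "exec (for_words ?i a (Sub 0 0 0) (sandwich ?p (emit a j (2 * j + 3))))
        (Y, inp, out @ ?I 0) (8 + ?n * (?tp + (?tq + ?tp) + 3))
        (Z, inp, (out @ ?I 0) @ concat (map (?g \<circ> Suc) u) @ [] @ concat (map (?g \<circ> Suc) v) @ [])"
      "agree_outside (?i + 2) Y Z"
      by blast
    have "exec (emit a (Suc j) r) (X, inp, out) (?tp + (8 + ?n * (?tp + (?tq + ?tp) + 3)))
        (Z, inp, (out @ ?I 0) @ concat (map (?g \<circ> Suc) u) @ [] @ concat (map (?g \<circ> Suc) v) @ [])"
      using True exec_Seq[OF Y(1) Z(1)] by simp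
    moreover have "(out @ ?I 0) @ concat (map (?g \<circ> Suc) u) @ [] @ concat (map (?g \<circ> Suc) v) @ [] =
        out @ map Suc (iterated_mix ?w (Suc j) x)"
      by (simp add: x iterated_mix_zero map_concat comp_def del: iterated_mix.simps)
    moreover have "?tp + (8 + ?n * (?tp + (?tq + ?tp) + 3)) = poly (emit_time (Suc j) (r = 1)) ?n"
      using True by (simp add: Let_def)
    moreover have "agree_outside (2 * Suc j + 2) X Z"
      by (rule agree_outside_trans[OF Y(2) Z(2)]) auto
    ultimately show ?thesis by metis
  qed
qed

text \<open>
  Reading stores each letter \<open>x\<close> of the input, which is coded as \<open>x + 1\<close>, as \<open>x + 2\<close>. This renames it to
  \<open>x + 1\<close> and thereby frees the letter \<open>0\<close>. Registers are initially \<open>0\<close>, so the terminating zeros of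
  the stored words need not be written.
\<close>

definition read_body :: "nat \<Rightarrow> prog" where
  "read_body i = Seq (Instr (Add (i + 1) (i + 1) 1)) (Seq (Instr (Store i (i + 1)))
     (Seq (Instr (Add i i 1)) (Instr (Read (i + 1)))))"

definition read_word :: "nat \<Rightarrow> prog" where
  "read_word i = Seq (Instr (Read (i + 1))) (While (i + 1) (read_body i))"

text \<open>
  When the loop condition is tested, the next input number is already in register \<open>i + 1\<close>; the remaining
  input is therefore described together with this register.
\<close>

lemma exec_read_loop:
  assumes "2 \<le> i"
  shows "X 1 = 1 \<Longrightarrow> i + 2 \<le> a \<Longrightarrow> X i = a \<Longrightarrow> map Suc w @ 0 # inp = X (i + 1) # rest \<Longrightarrow>
    \<exists>Y. exec (While (i + 1) (read_body i)) (X, rest, out) (1 + 5 * length w) (Y, inp, out) \<and>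
      Y i = a + length w \<and> (\<forall>l < length w. Y (a + l) = Suc (Suc (w ! l))) \<and>
      (\<forall>b. b \<noteq> i \<longrightarrow> b \<noteq> i + 1 \<longrightarrow> b < a \<or> a + length w \<le> b \<longrightarrow> Y b = X b)"
proof (induction w arbitrary: a X rest)
  case Nil
  then show ?case
    using exec_WhileFalse[of "(X, inp, out)" "i + 1" "read_body i"] by auto
next
  case (Cons c w)
  have rest: "X (i + 1) = Suc c" "rest = map Suc w @ 0 # inp" using Cons.prems(4) by auto
  obtain d rest' where rest': "map Suc w @ 0 # inp = d # rest'"
    by (cases "map Suc w @ 0 # inp") auto
  define Z where "Z = X(a := Suc (Suc c), i := a + 1, i + 1 := d)"
  have "exec (read_body i) (X, rest, out) (1 + (1 + (1 + 1))) (Z, rest', out)"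
    unfolding read_body_def
    by (intro exec_Seq; rule exec_InstrI; (rule refl)?)
      (use Cons.prems(1-3) rest rest' assms in \<open>auto simp: Z_def fun_eq_iff\<close>)
  moreover have "\<exists>Y. exec (While (i + 1) (read_body i)) (Z, rest', out) (1 + 5 * length w) (Y, inp, out) \<and>
      Y i = a + 1 + length w \<and> (\<forall>l < length w. Y (a + 1 + l) = Suc (Suc (w ! l))) \<and>
      (\<forall>b. b \<noteq> i \<longrightarrow> b \<noteq> i + 1 \<longrightarrow> b < a + 1 \<or> a + 1 + length w \<le> b \<longrightarrow> Y b = Z b)"
    by (rule Cons.IH) (use Cons.prems rest' assms in \<open>auto simp: Z_def\<close>)
  then obtain Y where Y: "exec (While (i + 1) (read_body i)) (Z, rest', out) (1 + 5 * length w) (Y, inp, out)"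
    "Y i = a + 1 + length w" "\<And>l. l < length w \<Longrightarrow> Y (a + 1 + l) = Suc (Suc (w ! l))"
    "\<And>b. b \<noteq> i \<Longrightarrow> b \<noteq> i + 1 \<Longrightarrow> b < a + 1 \<or> a + 1 + length w \<le> b \<Longrightarrow> Y b = Z b"
    by blast
  ultimately have "exec (While (i + 1) (read_body i)) (X, rest, out)
      ((1 + (1 + (1 + 1))) + (1 + 5 * length w) + 1) (Y, inp, out)"
    using rest by (intro exec_WhileTrue) auto
  then have "exec (While (i + 1) (read_body i)) (X, rest, out) (1 + 5 * length (c # w)) (Y, inp, out)"
    by (rule exec_time) simp
  moreover have "Y (a + l) = Suc (Suc ((c # w) ! l))" if "l < length (c # w)" for l
    using that Y(3)[of "l - 1"] Y(4)[of a] Cons.prems(2) by (cases l) (auto simp: Z_def)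
  moreover have "Y b = X b" if "b \<noteq> i" "b \<noteq> i + 1" "b < a \<or> a + length (c # w) \<le> b" for b
    using that Y(4)[of b] by (auto simp: Z_def)
  ultimately show ?case using Y(2) by (intro exI[of _ Y]) auto
qed

lemma exec_read_word:
  assumes "2 \<le> i" "X 1 = 1" "i + 2 \<le> a" "X i = a"
  shows "\<exists>Y. exec (read_word i) (X, map Suc w @ 0 # inp, out) (2 + 5 * length w) (Y, inp, out) \<and>
      Y i = a + length w \<and> (\<forall>l < length w. Y (a + l) = Suc (Suc (w ! l))) \<and>
      (\<forall>b. b \<noteq> i \<longrightarrow> b \<noteq> i + 1 \<longrightarrow> b < a \<or> a + length w \<le> b \<longrightarrow> Y b = X b)"
proof -
  obtain d rest where rest: "map Suc w @ 0 # inp = d # rest"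
    by (cases "map Suc w @ 0 # inp") auto
  define Z where "Z = X(i + 1 := d)"
  have "exec (Instr (Read (i + 1))) (X, map Suc w @ 0 # inp, out) 1 (Z, rest, out)"
    by (rule exec_InstrI) (simp add: rest Z_def)
  moreover have "\<exists>Y. exec (While (i + 1) (read_body i)) (Z, rest, out) (1 + 5 * length w) (Y, inp, out) \<and>
      Y i = a + length w \<and> (\<forall>l < length w. Y (a + l) = Suc (Suc (w ! l))) \<and>
      (\<forall>b. b \<noteq> i \<longrightarrow> b \<noteq> i + 1 \<longrightarrow> b < a \<or> a + length w \<le> b \<longrightarrow> Y b = Z b)"
    by (rule exec_read_loop) (use assms rest in \<open>auto simp: Z_def\<close>)
  then obtain Y where Y: "exec (While (i + 1) (read_body i)) (Z, rest, out) (1 + 5 * length w) (Y, inp, out)"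
    "Y i = a + length w" "\<forall>l < length w. Y (a + l) = Suc (Suc (w ! l))"
    "\<And>b. b \<noteq> i \<Longrightarrow> b \<noteq> i + 1 \<Longrightarrow> b < a \<or> a + length w \<le> b \<Longrightarrow> Y b = Z b"
    by blast
  ultimately have "exec (read_word i) (X, map Suc w @ 0 # inp, out) (1 + (1 + 5 * length w)) (Y, inp, out)"
    unfolding read_word_def by (intro exec_Seq)
  then have "exec (read_word i) (X, map Suc w @ 0 # inp, out) (2 + 5 * length w) (Y, inp, out)"
    by (rule exec_time) simp
  then show ?thesis using Y(2-4) by (intro exI[of _ Y]) (auto simp: Z_def)
qed

definition read_words :: "nat \<Rightarrow> nat \<Rightarrow> prog" where
  "read_words i a = Seq (Instr (Const 1 1)) (Seq (Instr (Const i a))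
     (Seq (read_word i) (Seq (Instr (Add i i 1)) (read_word i))))"

lemma exec_read_words:
  assumes "2 \<le> i" "i + 2 \<le> a"
  shows "\<exists>X. exec (read_words i a) (\<lambda>_. 0, encode (u, v), []) (7 + 5 * length (u @ v)) (X, [], []) \<and>
    stores a (map Suc u, map Suc v) X"
proof -
  let ?v = "map Suc v @ [0]"
  define X where "X = (\<lambda>_. 0 :: nat)(1 := 1, i := a)"
  have X: "X 1 = 1" "X i = a" using assms by (auto simp: X_def)
  obtain Y where Y: "exec (read_word i) (X, map Suc u @ 0 # ?v, []) (2 + 5 * length u) (Y, ?v, [])"
    "Y i = a + length u" "\<And>l. l < length u \<Longrightarrow> Y (a + l) = Suc (Suc (u ! l))"
    "\<And>b. b \<noteq> i \<Longrightarrow> b \<noteq> i + 1 \<Longrightarrow> b < a \<or> a + length u \<le> b \<Longrightarrow> Y b = X b"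
    using exec_read_word[OF assms(1) _ assms(2), of X u ?v "[]"] X by blast
  let ?b = "a + length u + 1"
  define Z where "Z = Y(i := ?b)"
  have Z: "Z 1 = 1" "Z i = ?b" using Y(4)[of 1] assms by (auto simp: Z_def X_def)
  obtain W where W: "exec (read_word i) (Z, ?v, []) (2 + 5 * length v) (W, [], [])"
    "\<And>l. l < length v \<Longrightarrow> W (?b + l) = Suc (Suc (v ! l))"
    "\<And>b. b \<noteq> i \<Longrightarrow> b \<noteq> i + 1 \<Longrightarrow> b < ?b \<or> ?b + length v \<le> b \<Longrightarrow> W b = Z b"
    using exec_read_word[OF assms(1) Z(1) _ Z(2), of v "[]" "[]"] assms(2) by auto
  have "exec (read_words i a) (\<lambda>_. 0, encode (u, v), [])
      (1 + (1 + ((2 + 5 * length u) + (1 + (2 + 5 * length v))))) (W, [], [])"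
    unfolding read_words_def
  proof (intro exec_Seq)
    show "exec (Instr (Const 1 1)) (\<lambda>_. 0, encode (u, v), []) 1 ((\<lambda>_. 0)(1 := 1), map Suc u @ 0 # ?v, [])"
      by (rule exec_InstrI) (simp add: encode_def)
    show "exec (Instr (Const i a)) ((\<lambda>_. 0)(1 := 1), map Suc u @ 0 # ?v, []) 1 (X, map Suc u @ 0 # ?v, [])"
      by (rule exec_InstrI) (simp add: X_def)
    show "exec (Instr (Add i i 1)) (Y, ?v, []) 1 (Z, ?v, [])"
      by (rule exec_InstrI) (use Y(2) Y(4)[of 1] assms in \<open>auto simp: Z_def X_def\<close>)
  qed (rule Y(1) W(1))+
  then have "exec (read_words i a) (\<lambda>_. 0, encode (u, v), []) (7 + 5 * length (u @ v)) (W, [], [])"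
    by (rule exec_time) simp
  moreover have "stores a (map Suc u, map Suc v) W"
  proof -
    have low: "W b = X b" if "b \<noteq> i" "b \<noteq> i + 1" "b < a" for b
      using that W(3)[of b] Y(4)[of b] by (simp add: Z_def)
    have "W (a + l) = encode (map Suc u, map Suc v) ! l" if "l < length (encode (map Suc u, map Suc v))" for l
    proof -
      have l: "l < length u + length v + 2" using that by (simp add: encode_def)
      consider "l < length u" | "l = length u" | "length u < l" "l < length u + 1 + length v"
        | "l = length u + 1 + length v"
        using l by linarith
      then show ?thesis
      proof cases
        case 1
        then show ?thesis using W(3)[of "a + l"] Y(3)[of l] assms
          by (simp add: Z_def encode_def nth_append)
      next
        case 2
        then show ?thesis using W(3)[of "a + l"] Y(4)[of "a + l"] assms
          by (simp add: Z_def X_def encode_def nth_append)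
      next
        case 3
        then obtain m where "l = length u + 1 + m" "m < length v"
          by (metis Suc_eq_plus1 Suc_leI le_add_diff_inverse nat_add_left_cancel_less)
        then show ?thesis using W(2)[of m] by (simp add: encode_def nth_append ac_simps)
      next
        case 4
        then show ?thesis using W(3)[of "a + l"] Y(4)[of "a + l"] assms
          by (simp add: Z_def X_def encode_def nth_append)
      qed
    qed
    then show ?thesis using low[of 0] low[of 1] assms by (simp add: stores_def X_def)
  qed
  ultimately show ?thesis by blast
qed

section \<open>The reduction\<close>

definition reduction :: "nat \<Rightarrow> identity \<Rightarrow> identity" where
  "reduction k = (\<lambda>(u, v). let s = iterated_mix (map Suc (u @ v)) k in
     (concat (map s (map Suc u)), concat (map s (map Suc v))))"

lemma polytime_computable_reduction: "polytime_computable (reduction k)"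
proof -
  define i where "i = 2 * k + 2"
  define a where "a = 2 * k + 4"
  define p where "p = Seq (read_words i a) (for_words i a (Print 0) (emit a k (i + 1)))"
  define T where "T = ([:7:] + [:5:] * [:0, 1:]) + ([:8:] + [:0, 1:] * (emit_time k False + [:3:]))"
  have "\<exists>t X inp. exec p (\<lambda>_. 0, encode (u, v), []) t (X, inp, encode (reduction k (u, v))) \<and>
      t \<le> poly T (length (u @ v))" for u v
  proof -
    let ?u = "map Suc u" and ?v = "map Suc v"
    let ?n = "length (u @ v)"
    let ?g = "\<lambda>c. map Suc (iterated_mix (?u @ ?v) k (c - 1))"
    obtain X where X: "exec (read_words i a) (\<lambda>_. 0, encode (u, v), []) (7 + 5 * ?n) (X, [], [])"
      "stores a (?u, ?v) X"
      using exec_read_words[of i a u v] by (auto simp: i_def a_def)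
    have body: "\<exists>Z'. exec (emit a k (i + 1)) (Z, [], out) (poly (emit_time k False) ?n)
        (Z', [], out @ ?g (Z (i + 1))) \<and> agree_outside i Z Z'"
      if Z: "agree_outside (i + 2) X Z" "Z (i + 1) \<in> Suc ` set (?u @ ?v)" for Z out
    proof -
      obtain z where z: "Z (i + 1) = Suc z" "z \<noteq> 0" using Z(2) by auto
      have "stores a (?u, ?v) Z" using stores_agree_outside[OF X(2) Z(1)] by (simp add: i_def a_def)
      then show ?thesis
        using exec_emit[of ?u ?v a Z k "i + 1" z "[]" out] z by (auto simp: i_def a_def)
    qed
    have "\<exists>Y. exec (for_words i a (Print 0) (emit a k (i + 1))) (X, [], [])
        (8 + length (?u @ ?v) * (poly (emit_time k False) ?n + 3))
        (Y, [], [] @ concat (map (?g \<circ> Suc) ?u) @ [0] @ concat (map (?g \<circ> Suc) ?v) @ [0]) \<and>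
        agree_outside (i + 2) X Y"
      by (rule exec_for_words[OF body X(2)]) (auto simp: i_def a_def)
    moreover have "[] @ concat (map (?g \<circ> Suc) ?u) @ [0] @ concat (map (?g \<circ> Suc) ?v) @ [0] =
        encode (reduction k (u, v))"
      by (simp add: encode_def reduction_def Let_def map_concat comp_def)
    ultimately obtain Y where Y: "exec (for_words i a (Print 0) (emit a k (i + 1))) (X, [], [])
        (8 + length (?u @ ?v) * (poly (emit_time k False) ?n + 3)) (Y, [], encode (reduction k (u, v)))"
      by metis
    show ?thesis using exec_Seq[OF X(1) Y] unfolding p_def
      by (intro exI conjI) (assumption, simp add: T_def algebra_simps)
  qed
  then show ?thesis unfolding polytime_computable_def by blast
qed

lemma length_output_le_time:
  "exec p s t s' \<Longrightarrow> length (snd (snd s')) \<le> length (snd (snd s)) + t"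
proof (induction rule: exec.induct)
  case (exec_Instr c s)
  then show ?case by (cases c; cases s) (auto split: list.split)
qed auto

text \<open>The witness is \<open>q\<close> evaluated at the sum of the two indeterminates, by Horner's rule.\<close>

lemma ex_poly2_of_sum: "\<exists>P. \<forall>m n. poly2 P m n = poly q (m + n)"
proof (induction q)
  case 0
  show ?case by (intro exI[of _ 0]) (simp add: poly2_def)
next
  case (pCons c q)
  then obtain P where "\<forall>m n. poly2 P m n = poly q (m + n)" by blast
  then have "\<forall>m n. poly2 ([:[:c:]:] + [:[:0, 1:], 1:] * P) m n = poly (pCons c q) (m + n)"
    by (simp add: poly2_def algebra_simps)
  then show ?case by blast
qed

lemma polytime_computable_length:
  assumes "polytime_computable F"
  shows "\<exists>P. \<forall>(u, v) \<in> identities. case F (u, v) of (U, V) \<Rightarrow>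
    length U \<le> poly2 P (length u) (length v) \<and> length V \<le> poly2 P (length u) (length v)"
proof -
  obtain p T where pT: "\<forall>(u, v) \<in> identities. \<exists>t X inp.
      exec p (\<lambda>_. 0, encode (u, v), []) t (X, inp, encode (F (u, v))) \<and> t \<le> poly T (length (u @ v))"
    using assms unfolding polytime_computable_def by blast
  obtain P where P: "\<forall>m n. poly2 P m n = poly T (m + n)" using ex_poly2_of_sum by blast
  have "length U \<le> poly2 P (length u) (length v) \<and> length V \<le> poly2 P (length u) (length v)"
    if uv: "(u, v) \<in> identities" and F: "F (u, v) = (U, V)" for u v U V
  proof -
    obtain t X inp where "exec p (\<lambda>_. 0, encode (u, v), []) t (X, inp, encode (U, V))"
      "t \<le> poly T (length (u @ v))"
      using pT uv F by fastforce
    then have "length (encode (U, V)) \<le> poly T (length (u @ v))"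
      using length_output_le_time by fastforce
    then show ?thesis using P by (simp add: encode_def)
  qed
  then show ?thesis by (intro exI[of _ P]) (auto split: prod.split)
qed

text \<open>
  Satisfaction of the image says that \<open>u\<close> and \<open>v\<close> agree under all assignments of the form
  \<open>\<phi> \<circ> \<tau>\<^sup>k\<close>. All these have their values on \<open>uv\<close> in some maximal subgroup, and every
  assignment into a maximal subgroup is of this form.
\<close>

lemma (in semigroup) satisfies_reduction_iff:
  assumes "stable_semigroup f" "finite (UNIV // green_J f)" "u \<noteq> []" "v \<noteq> []"
  shows "satisfies UNIV f (reduction (card (UNIV // green_J f)) (u, v)) \<longleftrightarrow>
    (\<forall>H \<in> maximal_subgroups f. satisfies H f (u, v))"
proof -
  let ?k = "card (UNIV // green_J f)"
  define w where "w = map Suc (u @ v)"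
  have w: "w \<noteq> []" "0 \<notin> set w" using assms(3) by (auto simp: w_def)
  let ?A = "\<lambda>\<phi>. (advance f w ^^ ?k) \<phi>"
  have Suc: "word_value f \<phi> (map Suc z) = word_value f (\<lambda>x. \<phi> (Suc x)) z" if "z \<noteq> []" for \<phi> z
    using that by (induction z rule: list_nonempty_induct) (auto simp: word_value_Cons)
  have "satisfies UNIV f (reduction ?k (u, v)) \<longleftrightarrow>
      (\<forall>\<phi>. word_value f (?A \<phi>) (map Suc u) = word_value f (?A \<phi>) (map Suc v))"
    using assms(3,4) by (simp add: satisfies_def reduction_def Let_def w_def
        word_value_concat_iterated_mix del: map_map)
  also have "\<dots> \<longleftrightarrow>
      (\<forall>\<phi>. word_value f (\<lambda>x. ?A \<phi> (Suc x)) u = word_value f (\<lambda>x. ?A \<phi> (Suc x)) v)"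
    using assms(3,4) by (simp add: Suc)
  also have "\<dots> \<longleftrightarrow> (\<forall>H \<in> maximal_subgroups f. satisfies H f (u, v))"
  proof (intro iffI ballI allI)
    fix \<phi> assume sat: "\<forall>H \<in> maximal_subgroups f. satisfies H f (u, v)"
    obtain H where "H \<in> maximal_subgroups f" "\<And>x. x \<in> set w \<Longrightarrow> ?A \<phi> x \<in> H"
      using iterated_advance_in_maximal_subgroup[OF assms(1,2) w] by blast
    then show "word_value f (\<lambda>x. ?A \<phi> (Suc x)) u = word_value f (\<lambda>x. ?A \<phi> (Suc x)) v"
      using sat by (auto simp: satisfies_def w_def)
  next
    fix H assume eq: "\<forall>\<phi>. word_value f (\<lambda>x. ?A \<phi> (Suc x)) u = word_value f (\<lambda>x. ?A \<phi> (Suc x)) v"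
      and "H \<in> maximal_subgroups f"
    then obtain e where H: "group \<lparr>carrier = H, monoid.mult = f, one = e\<rparr>"
      using maximal_subgroupsE by blast
    then have e: "e \<in> H" using monoid.one_closed[OF group.is_monoid[OF H]] by simp
    show "satisfies H f (u, v)"
      unfolding satisfies_def prod.case
    proof
      fix \<psi> assume \<psi>: "\<psi> \<in> set (u @ v) \<rightarrow> H"
      define \<chi> where "\<chi> x = (if x \<in> set w then \<psi> (x - 1) else e)" for x
      have "\<forall>x. \<chi> x \<in> H" using \<psi> e by (auto simp: \<chi>_def w_def)
      then obtain \<phi> where "?A \<phi> = \<chi>"
        using iterated_advance_in_group_surjective[OF H w] by blast
      then have "word_value f (\<lambda>x. \<chi> (Suc x)) u = word_value f (\<lambda>x. \<chi> (Suc x)) v"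
        using eq by metis
      moreover have "word_value f (\<lambda>x. \<chi> (Suc x)) z = word_value f \<psi> z" if "z = u \<or> z = v" for z
        by (rule word_value_cong) (use that assms(3,4) in \<open>auto simp: \<chi>_def w_def\<close>)
      ultimately show "word_value f \<psi> u = word_value f \<psi> v" by metis
    qed
  qed
  finally show ?thesis .
qed

lemma reduction_in_identities: "reduction k \<in> identities \<rightarrow> identities"
proof
  fix i assume "i \<in> identities"
  then obtain u v where "i = (u, v)" "u \<noteq> []" "v \<noteq> []" by (auto simp: identities_def)
  then show "reduction k i \<in> identities"
    by (cases u; cases v) (auto simp: identities_def reduction_def Let_def)
qed

theorem theorem3p1:
  fixes f :: "'a \<Rightarrow> 'a \<Rightarrow> 'a"
  assumes "semigroup f"
    and "stable_semigroup f"
    and "finite (UNIV // green_J f)"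
  defines "G \<equiv> maximal_subgroups_product f"
  shows "\<exists>F. polynomial_reduction F (check_id (carrier G) (monoid.mult G)) (check_id UNIV f)"
proof -
  interpret semigroup f by fact
  let ?F = "reduction (card (UNIV // green_J f))"
  have "?F i \<in> check_id UNIV f \<longleftrightarrow> i \<in> check_id (carrier G) (monoid.mult G)"
    if i: "i \<in> identities" for i
  proof -
    obtain u v where uv: "i = (u, v)" "u \<noteq> []" "v \<noteq> []"
      using i by (auto simp: identities_def)
    have "?F i \<in> identities" using reduction_in_identities i by blast
    then show ?thesis
      using i satisfies_reduction_iff[OF assms(2,3) uv(2,3)]
        satisfies_maximal_subgroups_product_iff[OF uv(2,3), of f]
      unfolding check_id_def uv(1) G_def by blast
  qed
  then have "polynomial_reduction ?F (check_id (carrier G) (monoid.mult G)) (check_id UNIV f)"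
    unfolding polynomial_reduction_def
    using reduction_in_identities polytime_computable_reduction
      polytime_computable_length[OF polytime_computable_reduction] by blast
  then show ?thesis by blast
qed

end
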